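(* Let $N\ge2$. Let $d(s)$ be a real monic polynomial of degree $N$ whose zeros $\delta_1,\dots,\delta_N$ are distinct and lie in the open left half plane, and let $e(s)$ be a real polynomial of degree at most $N-1$, coprime to $d$, so that $e/d\in\Sigma S_N$. Let $$M=\mathrm{diag}(e(\delta_1),\dots,e(\delta_N))\,V(\delta_1,\dots,\delta_N)\,V(-\delta_1,\dots,-\delta_N)^{-1},$$ and let $\Xi$ be the set of $x\in\mathbb{C}^N\setminus\{0\}$ satisfying $x_i^2=(Mx)_i$ for $i=1,\dots,N$. (i) The number of critical points of the function $f:\Sigma S_{N-1}\to[0,\infty)$, $f(b/a)=\|e/d-b/a\|_2^2$, is finite and at most $2^N-1$. (ii) If $b/a\in\Sigma S_{N-1}$ (with $a$ monic) is a critical point of $f$, then there exist a number $q_0$ and a vector $\xi\in\Xi$ such that $q_0a(-\delta_i)=\xi_i$ for $i=1,\dots,N$. For given $q_0$ and $\xi$, the polynomial $a$ is uniquely determined by this linear system, and $b$ is uniquely determined by $b(s)=\bigl(e(s)a(s)-q_0a(-s)^2\bigr)/d(s)$.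
   Context: $V(\delta_1,\dots,\delta_N)$ is the $N\times N$ Vandermonde matrix whose $i$-th row is $(1,\delta_i,\delta_i^2,\dots,\delta_i^{N-1})$. For $n\ge1$, $\Sigma S_n$ denotes the set (a differentiable manifold) of real rational functions $b(s)/a(s)$ with $a,b$ real coprime polynomials, $a$ a monic Hurwitz polynomial (all zeros in the open left half plane) of degree $n$ and $\deg b<n$. For such strictly proper stable rational functions $t$, $\|t\|_2^2=\frac{1}{2\pi}\int_{-\infty}^{\infty}|t(i\omega)|^2\,d\omega$ (the $H_2$ norm). A critical point of $f$ is a point of the manifold $\Sigma S_{N-1}$ where the differential of $f$ vanishes. *)

theory Defs
  imports "HOL-Analysis.Analysis" "HOL-Computational_Algebra.Polynomial"
    "Jordan_Normal_Form.Gauss_Jordan_Elimination"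
begin

abbreviation cpoly :: "real poly \<Rightarrow> complex poly" where
  "cpoly p \<equiv> map_poly complex_of_real p"

definition hurwitz :: "real poly \<Rightarrow> bool" where
  "hurwitz a \<longleftrightarrow> (\<forall>z. poly (cpoly a) z = 0 \<longrightarrow> Re z < 0)"

text \<open>The pair (a,b) represents the element b/a of Sigma S_n
  (a monic Hurwitz of degree n, deg b < n, a and b coprime).\<close>
definition SigmaS :: "nat \<Rightarrow> real poly \<Rightarrow> real poly \<Rightarrow> bool" where
  "SigmaS n a b \<longleftrightarrow> lead_coeff a = 1 \<and> degree a = n \<and> hurwitz a \<and>
     degree b < n \<and> coprime a b"

definition rat_at_iw :: "real poly \<Rightarrow> real poly \<Rightarrow> real \<Rightarrow> complex" where
  "rat_at_iw b a w = poly (cpoly b) (\<i> * of_real w) / poly (cpoly a) (\<i> * of_real w)"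

definition H2_err_sq :: "real poly \<Rightarrow> real poly \<Rightarrow> real poly \<Rightarrow> real poly \<Rightarrow> real" where
  "H2_err_sq e d b a =
     (1 / (2 * pi)) * (LINT w|lborel. (cmod (rat_at_iw e d w - rat_at_iw b a w))\<^sup>2)"

definition coeff_norm :: "real poly \<Rightarrow> real" where
  "coeff_norm p = (\<Sum>i\<le>degree p. \<bar>coeff p i\<bar>)"

text \<open>Critical point of F(b/a) on Sigma S_n: the differential of F vanishes in the
  global coefficient chart (lower coefficients of a, coefficients of b), i.e.
  F has zero Frechet derivative there.\<close>
definition critical_point ::
  "(real poly \<Rightarrow> real poly \<Rightarrow> real) \<Rightarrow> nat \<Rightarrow> real poly \<Rightarrow> real poly \<Rightarrow> bool" where
  "critical_point F n b a \<longleftrightarrow> SigmaS n a b \<and>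
     (\<forall>\<epsilon>>0. \<exists>\<delta>>0. \<forall>\<alpha> \<beta>. degree \<alpha> < n \<longrightarrow> degree \<beta> < n \<longrightarrow>
        coeff_norm \<alpha> + coeff_norm \<beta> < \<delta> \<longrightarrow>
        \<bar>F (b + \<beta>) (a + \<alpha>) - F b a\<bar> \<le> \<epsilon> * (coeff_norm \<alpha> + coeff_norm \<beta>))"

definition vandermonde :: "nat \<Rightarrow> (nat \<Rightarrow> complex) \<Rightarrow> complex mat" where
  "vandermonde N x = mat N N (\<lambda>(i,j). x i ^ j)"

definition Mmat :: "nat \<Rightarrow> (nat \<Rightarrow> complex) \<Rightarrow> real poly \<Rightarrow> complex mat" where
  "Mmat N \<delta> e =
     mat N N (\<lambda>(i,j). if i = j then poly (cpoly e) (\<delta> i) else 0)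
     * vandermonde N \<delta> * the (mat_inverse (vandermonde N (\<lambda>i. - \<delta> i)))"

definition Xi :: "nat \<Rightarrow> (nat \<Rightarrow> complex) \<Rightarrow> real poly \<Rightarrow> complex vec set" where
  "Xi N \<delta> e = {x. x \<in> carrier_vec N \<and> x \<noteq> 0\<^sub>v N \<and>
      (\<forall>i<N. (x $ i)\<^sup>2 = (Mmat N \<delta> e *\<^sub>v x) $ i)}"

end

theory Submission
  imports Defs
    "HOL-Complex_Analysis.Cauchy_Integral_Theorem"
    "HOL-Probability.Sinc_Integral"
    "HOL-Library.Function_Algebras"
    "HOL-Computational_Algebra.Field_as_Ring"
    "HOL-Computational_Algebra.Fundamental_Theorem_Algebra"
    "Jordan_Normal_Form.Determinant"
begin

text \<open>
  The tangent vectors of \<^term>\<open>SigmaS n\<close> at b/a are, by coprimality, all the fractions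
  p/a^2 with deg p < 2n. So at a critical point the error r/(da), where r = ea - bd, is
  orthogonal to each of them. Write a* for a(-s) and decompose r a^2 = h a*^2 + p d a with
  deg p < 2n. Then r/(da) = p/a^2 + (a*/a)^2 h/(da), and the second summand is orthogonal to
  p/a^2 by Cauchy's theorem in the right half plane. Hence p = 0, so a*^2 divides r, and
  comparing degrees gives ea - bd = q0 a*^2. Evaluating at the zeros of d turns this into the
  quadratic system defining \<^const>\<open>Xi\<close>. That system, including the solution 0, has at
  most 2^N solutions because the 2^N square-free monomials span the functions on any finite
  set of solutions.
\<close>

section \<open>Rational functions on the imaginary axis\<close>

text \<open>Criticality is a Frechet condition in the coefficient chart, while the error is a
  Lebesgue integral. Instead of differentiating under the integral sign, the perturbed fraction is
  expanded exactly along a line (t \<alpha>, t \<beta>), with a remainder of order t^2 after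
  integration. At each critical point only one direction is tested, the fraction p/a^2 produced by
  the decomposition: its inner product with the error is its own squared norm. The decomposition
  exists because a* has its zeros in the right half plane and d a in the left one. For real
  coefficients, conjugation on the imaginary axis is the reflection s -> -s, so the cross term
  becomes the integral of a rational function. There a*^2 cancels, and the degree bounds leave two
  orders of decay. Cauchy's theorem enters through a primitive on the convex right half plane. The
  count of solutions bounds the count of critical points because a is monic: q0 is the leading
  coefficient of q0 a, so distinct critical points give distinct solutions.\<close>

lemma rhp_poly_bound:
  fixes P D :: "complex poly"
  assumes "\<And>z. poly D z = 0 \<Longrightarrow> Re z < 0" and "degree P \<le> degree D"
  shows "\<exists>C\<ge>0. \<forall>s. 0 \<le> Re s \<longrightarrow> cmod (poly P s) \<le> C * cmod (poly D s)"
  using assms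
proof (induction "degree D" arbitrary: P D)
  case 0
  then obtain c p where D: "D = [:c:]" and P: "P = [:p:]"
    by (metis degree_eq_zeroE le_zero_eq)
  from 0(2)[of 0] D have "c \<noteq> 0" by auto
  then show ?case
    unfolding D P by (intro exI[of _ "cmod p / cmod c"]) auto
next
  case (Suc n)
  have "\<not> constant (poly D)"
    using Suc.hyps(2) by (simp add: constant_degree)
  then obtain z where z: "poly D z = 0"
    using fundamental_theorem_of_algebra by blast
  have rez: "Re z < 0" using Suc.prems(1) z by blast
  from z obtain D' where D: "D = [:-z, 1:] * D'"
    by (metis dvdE poly_eq_0_iff_dvd)
  have "D' \<noteq> 0" using D Suc.hyps(2) by auto
  then have degD': "degree D' = n"
    using D Suc.hyps(2) by (simp add: degree_mult_eq del: mult_pCons_left)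
  have rD': "Re w < 0" if "poly D' w = 0" for w
    using Suc.prems(1)[of w] that D by simp
  define Q where "Q = synthetic_div P z"
  \<comment> \<open>Quotient and constant remainder both have degree at most n, so the induction
    hypothesis bounds each of them by \<open>D'\<close>.\<close>
  have P: "P = [:-z, 1:] * Q + [:poly P z:]"
    unfolding Q_def by (rule synthetic_div_correct'[symmetric])
  have "degree Q \<le> n"
    unfolding Q_def degree_synthetic_div using Suc by simp
  then obtain C1 where C1: "C1 \<ge> 0" "\<And>s. 0 \<le> Re s \<Longrightarrow> cmod (poly Q s) \<le> C1 * cmod (poly D' s)"
    using Suc.hyps(1)[of D' Q] degD' rD' by blast
  obtain C2 where C2: "C2 \<ge> 0"
    "\<And>s. 0 \<le> Re s \<Longrightarrow> cmod (poly [:poly P z:] s) \<le> C2 * cmod (poly D' s)"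
    using Suc.hyps(1)[of D' "[:poly P z:]"] degD' rD' by auto
  show ?case
  proof (intro exI[of _ "C1 + C2 / (- Re z)"] conjI allI impI)
    show "C1 + C2 / (- Re z) \<ge> 0"
      using C1 C2 rez by (intro add_nonneg_nonneg divide_nonneg_nonneg) auto
  next
    fix s assume s: "0 \<le> Re s"
    have "- Re z \<le> Re (s - z)" using s by simp
    also have "\<dots> \<le> cmod (s - z)" by (rule complex_Re_le_cmod)
    finally have sz: "- Re z \<le> cmod (s - z)" .
    have "cmod (poly P s) = cmod ((s - z) * poly Q s + poly P z)"
      by (subst P) (simp add: algebra_simps)
    also have "\<dots> \<le> cmod (s - z) * cmod (poly Q s) + cmod (poly P z)"
      by (metis norm_mult norm_triangle_ineq)
    also have "\<dots> \<le> cmod (s - z) * (C1 * cmod (poly D' s)) + C2 * cmod (poly D' s)"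
      using C1(2)[OF s] C2(2)[OF s] by (intro add_mono mult_left_mono) auto
    \<comment> \<open>The remainder lacks the factor \<open>cmod (s - z)\<close> that turns
      \<open>D'\<close> into \<open>D\<close>. Since this factor is at least \<open>- Re z\<close>,
      inserting it costs the constant 1 / (- Re z).\<close>
    also have "C2 * cmod (poly D' s) \<le> C2 * cmod (poly D' s) * (cmod (s - z) / (- Re z))"
    proof -
      have "1 \<le> cmod (s - z) / (- Re z)" using sz rez by (simp add: field_simps)
      from mult_left_mono[OF this, of "C2 * cmod (poly D' s)"] show ?thesis using C2(1) by simp
    qed
    also have "cmod (s - z) * (C1 * cmod (poly D' s)) + C2 * cmod (poly D' s) * (cmod (s - z) / (- Re z))
        = (C1 + C2 / (- Re z)) * cmod (poly D s)"
    proof -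
      have "poly D s = (s - z) * poly D' s" by (simp add: D algebra_simps)
      then have "cmod (poly D s) = cmod (s - z) * cmod (poly D' s)" by (simp add: norm_mult)
      then show ?thesis by (simp only:) (simp add: algebra_simps)
    qed
    finally show "cmod (poly P s) \<le> (C1 + C2 / (- Re z)) * cmod (poly D s)" by simp
  qed
qed

text \<open>Multiplying \<open>P\<close> by (1 + s)^k reduces decay to boundedness. The comparison
  uses 1 + s rather than s because it has no zero in the closed half plane and its squared modulus
  on the axis, 1 + w^2, has an integrable reciprocal.\<close>

lemma rhp_rational_decay:
  fixes P D :: "complex poly"
  assumes "\<And>z. poly D z = 0 \<Longrightarrow> Re z < 0" and "degree P + k \<le> degree D"
  shows "\<exists>C\<ge>0. \<forall>s. 0 \<le> Re s \<longrightarrow> cmod (poly P s / poly D s) \<le> C / cmod (1 + s) ^ k"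
proof -
  have "degree (P * [:1, 1:] ^ k) \<le> degree D"
    using assms(2) degree_mult_le[of P "[:1, 1:] ^ k"] by (simp add: degree_linear_power)
  then obtain C where C: "C \<ge> 0"
    "\<And>s. 0 \<le> Re s \<Longrightarrow> cmod (poly (P * [:1, 1:] ^ k) s) \<le> C * cmod (poly D s)"
    using rhp_poly_bound[of D "P * [:1, 1:] ^ k"] assms(1) by blast
  have "cmod (poly P s / poly D s) \<le> C / cmod (1 + s) ^ k" if s: "0 \<le> Re s" for s
  proof -
    have "poly D s \<noteq> 0" "1 + s \<noteq> 0"
      using assms(1)[of s] s by (auto simp: complex_eq_iff)
    then show ?thesis
      using C(2)[OF s] by (simp add: norm_divide norm_mult norm_power field_simps)
  qed
  with C show ?thesis by blast
qed

lemma cmod_1_plus_ii: "cmod (1 + \<i> * of_real w) ^ 2 = 1 + w\<^sup>2"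
  by (simp add: cmod_power2)

lemma integrable_const_over_1_plus_square: "integrable lborel (\<lambda>w::real. c / (1 + w\<^sup>2))"
proof -
  have "integrable lborel (\<lambda>w::real. inverse (1 + w\<^sup>2))"
    using integrable_inverse_1_plus_square by (simp add: set_integrable_def einterval_def)
  then have "integrable lborel (\<lambda>w::real. c * inverse (1 + w\<^sup>2))"
    by (rule integrable_mult_right)
  then show ?thesis by (simp add: divide_inverse)
qed

section \<open>Integrals of rational functions along the imaginary axis\<close>

lemma continuous_on_rational_ii:
  fixes P D :: "complex poly"
  assumes "\<And>z. poly D z = 0 \<Longrightarrow> Re z < 0"
  shows "continuous_on A (\<lambda>w. poly P (\<i> * of_real w) / poly D (\<i> * of_real w))"
proof -
  have "poly D (\<i> * of_real w) \<noteq> 0" for w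
    using assms[of "\<i> * of_real w"] by auto
  then show ?thesis by (intro continuous_intros) auto
qed

lemma borel_measurable_rational_ii:
  fixes P D :: "complex poly"
  assumes "\<And>z. poly D z = 0 \<Longrightarrow> Re z < 0"
  shows "(\<lambda>w. poly P (\<i> * of_real w) / poly D (\<i> * of_real w)) \<in> borel_measurable lborel"
  using continuous_on_rational_ii[OF assms, where A = UNIV and P = P]
  by (simp add: borel_measurable_continuous_onI)

lemma integrable_rational_ii:
  fixes P D :: "complex poly"
  assumes "\<And>z. poly D z = 0 \<Longrightarrow> Re z < 0" and "degree P + 2 \<le> degree D"
  shows "integrable lborel (\<lambda>w. poly P (\<i> * of_real w) / poly D (\<i> * of_real w))"
proof -
  obtain C where C: "C \<ge> 0" "\<And>s. 0 \<le> Re s \<Longrightarrow> cmod (poly P s / poly D s) \<le> C / cmod (1 + s) ^ 2"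
    using rhp_rational_decay[OF assms] by blast
  have "cmod (poly P (\<i> * of_real w) / poly D (\<i> * of_real w)) \<le> C / (1 + w\<^sup>2)" for w
    using C(2)[of "\<i> * of_real w"] by (simp add: cmod_1_plus_ii)
  then show ?thesis
    by (intro Bochner_Integration.integrable_bound[OF integrable_const_over_1_plus_square[of C]]
        borel_measurable_rational_ii assms(1)) (use C(1) in auto)
qed

text \<open>All poles lie to the left, so the integrand has a primitive on the closed right half
  plane, and the integral over [-R, R] is a difference of two of its values up to the factor 1/i.
  Going around the other three sides of a rectangle, where the integrand is O(1/R^2), shows that
  this difference is O(1/R).\<close>

lemma integral_rational_ii_eq_0:
  fixes P D :: "complex poly"
  assumes roots: "\<And>z. poly D z = 0 \<Longrightarrow> Re z < 0" and deg: "degree P + 2 \<le> degree D"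
  shows "(LINT w|lborel. poly P (\<i> * of_real w) / poly D (\<i> * of_real w)) = 0"
proof -
  define S where "S = {s::complex. 0 \<le> Re s}"
  define f where "f = (\<lambda>s. poly P s / poly D s)"
  obtain C where C: "C \<ge> 0" "\<And>s. 0 \<le> Re s \<Longrightarrow> cmod (f s) \<le> C / cmod (1 + s) ^ 2"
    unfolding f_def using rhp_rational_decay[OF roots deg] by blast
  have D0: "poly D s \<noteq> 0" if "s \<in> S" for s
    using roots[of s] that by (auto simp: S_def)
  have convS: "convex S"
    unfolding S_def by (rule convex_halfspace_Re_ge)
  obtain g where g: "\<And>s. s \<in> S \<Longrightarrow> (g has_field_derivative f s) (at s within S)"
  \<comment> \<open>Continuity up to the boundary and differentiability inside give a primitive
    whose derivative within \<open>S\<close> exists on the axis too, where the fundamental theorem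
    of calculus is applied.\<close>
  proof (rule holomorphic_convex_primitive[OF convS finite.emptyI, of f])
    fix g assume *: "\<And>g. (\<And>s. s \<in> S \<Longrightarrow> (g has_field_derivative f s) (at s within S)) \<Longrightarrow> thesis"
      "\<And>x. x \<in> S \<Longrightarrow> (g has_field_derivative f x) (at x within S)"
    show thesis by (rule *(1)) (rule *(2))
  next
    show "continuous_on S f"
      unfolding f_def using D0 by (intro continuous_intros) auto
    fix s assume "s \<in> interior S - {}"
    then have "s \<in> S" using interior_subset by auto
    then show "f field_differentiable at s"
      unfolding f_def using D0[of s]
      by (intro derivative_intros) (auto simp: field_differentiable_def intro: poly_DERIV)
  qed
  \<comment> \<open>Mean value inequality on a convex set that stays at distance at least R from 0;
    for \<open>0 \<le> Re s\<close> one has \<open>cmod s \<le> cmod (1 + s)\<close>, hence the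
    bound C / R^2 on f.\<close>
  have step: "cmod (g x - g y) \<le> C / R\<^sup>2 * (2 * R)"
    if R: "R > 0" and conv: "convex T" and T: "\<And>s. s \<in> T \<Longrightarrow> 0 \<le> Re s \<and> R \<le> cmod s"
      and xy: "x \<in> T" "y \<in> T" "cmod (x - y) \<le> 2 * R" for R T x y
  proof -
    have "cmod (g x - g y) \<le> C / R\<^sup>2 * cmod (x - y)"
    proof (rule field_differentiable_bound[OF conv _ _ xy(1,2)])
      fix s assume s: "s \<in> T"
      then have "s \<in> S" "T \<subseteq> S" using T by (auto simp: S_def)
      then show "(g has_field_derivative f s) (at s within T)"
        using g by (blast intro: DERIV_subset)
      have "R\<^sup>2 \<le> (cmod s)\<^sup>2" using T[OF s] R by (intro power_mono) auto
      also have "\<dots> \<le> (cmod (1 + s))\<^sup>2"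
        using T[OF s] unfolding cmod_power2 by (simp add: power2_eq_square algebra_simps)
      finally have "C / (cmod (1 + s))\<^sup>2 \<le> C / R\<^sup>2"
        using C(1) R by (intro divide_left_mono mult_pos_pos) (auto intro: less_le_trans[of 0 "R\<^sup>2"])
      then show "cmod (f s) \<le> C / R\<^sup>2"
        using C(2)[of s] T[OF s] by auto
    qed
    also have "\<dots> \<le> C / R\<^sup>2 * (2 * R)"
      using xy C(1) by (intro mult_left_mono) auto
    finally show ?thesis .
  qed
  have g_bound: "cmod (g (\<i> * of_real R) - g (- \<i> * of_real R)) \<le> 6 * C / R" if R: "R > 0" for R
  proof -
    \<comment> \<open>The path runs through the corners R + iR and R - iR. Its sides lie in convex
      sets outside the open disc of radius R and have length at most 2R, so each contributes at most
      2C/R.\<close>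
    let ?p = "\<i> * of_real R" and ?q = "Complex R R" and ?r = "Complex R (-R)" and ?t = "- \<i> * of_real R"
    have 1: "cmod (g ?p - g ?q) \<le> C / R\<^sup>2 * (2 * R)"
    proof (rule step[OF R, of "{s. 0 \<le> Re s} \<inter> {s. R \<le> Im s}"])
      show "cmod (?p - ?q) \<le> 2 * R" using R by (simp add: cmod_def)
      fix s assume "s \<in> {s. 0 \<le> Re s} \<inter> {s. R \<le> Im s}"
      then show "0 \<le> Re s \<and> R \<le> cmod s" using abs_Im_le_cmod[of s] by auto
    qed (use R in \<open>auto intro!: convex_Int convex_halfspace_Re_ge convex_halfspace_Im_ge\<close>)
    have 2: "cmod (g ?q - g ?r) \<le> C / R\<^sup>2 * (2 * R)"
    proof (rule step[OF R, of "{s. R \<le> Re s}"])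
      show "cmod (?q - ?r) \<le> 2 * R" using R by (simp add: cmod_def real_sqrt_mult)
    qed (use R in \<open>auto intro!: convex_halfspace_Re_ge intro: order_trans[OF _ complex_Re_le_cmod]\<close>)
    have 3: "cmod (g ?r - g ?t) \<le> C / R\<^sup>2 * (2 * R)"
    proof (rule step[OF R, of "{s. 0 \<le> Re s} \<inter> {s. Im s \<le> - R}"])
      show "cmod (?r - ?t) \<le> 2 * R" using R by (simp add: cmod_def)
      fix s assume "s \<in> {s. 0 \<le> Re s} \<inter> {s. Im s \<le> - R}"
      then show "0 \<le> Re s \<and> R \<le> cmod s" using abs_Im_le_cmod[of s] by auto
    qed (use R in \<open>auto intro!: convex_Int convex_halfspace_Re_ge convex_halfspace_Im_le\<close>)
    have "cmod (g ?p - g ?t) \<le> cmod (g ?p - g ?q) + cmod (g ?q - g ?r) + cmod (g ?r - g ?t)"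
      using norm_triangle_ineq[of "g ?p - g ?q + (g ?q - g ?r)" "g ?r - g ?t"]
        norm_triangle_ineq[of "g ?p - g ?q" "g ?q - g ?r"] by simp
    also have "\<dots> \<le> 3 * (C / R\<^sup>2 * (2 * R))" using 1 2 3 by simp
    also have "\<dots> = 6 * C / R" using R by (simp add: power2_eq_square field_simps)
    finally show ?thesis .
  qed
  let ?h = "\<lambda>w::real. f (\<i> * of_real w)"
  have int: "integrable lborel ?h"
    unfolding f_def by (rule integrable_rational_ii[OF roots deg])
  have cont: "continuous_on A ?h" for A
    unfolding f_def by (rule continuous_on_rational_ii[OF roots])
  have gder: "((\<lambda>w::real. g (\<i> * of_real w)) has_vector_derivative \<i> * ?h w) (at w within A)" for w A
  proof -
    have "((\<lambda>w::real. \<i> * of_real w) has_vector_derivative \<i>) (at w within A)"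
      by (auto intro!: derivative_eq_intros)
    moreover have "(g has_field_derivative ?h w) (at (\<i> * of_real w) within (\<lambda>w. \<i> * of_real w) ` A)"
      by (rule DERIV_subset[OF g]) (auto simp: S_def)
    ultimately show ?thesis
      using field_vector_diff_chain_within[of "\<lambda>w. \<i> * of_real w" \<i> w A g "?h w"] by (simp add: o_def)
  qed
  have part: "(LINT w|lborel. indicator {-R..R} w *\<^sub>R ?h w) = (g (\<i> * of_real R) - g (- \<i> * of_real R)) / \<i>"
    if "R > 0" for R
  proof -
    have "(LINT w|lborel. indicator {-R..R} w *\<^sub>R (\<i> * ?h w)) = g (\<i> * of_real R) - g (\<i> * of_real (-R))"
      by (rule integral_FTC_Icc[where F = "\<lambda>w. g (\<i> * of_real w)"])
        (use that gder cont in \<open>auto intro!: continuous_intros\<close>)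
    moreover have "(LINT w|lborel. indicator {-R..R} w *\<^sub>R (\<i> * ?h w)) = \<i> * (LINT w|lborel. indicator {-R..R} w *\<^sub>R ?h w)"
      by (subst integral_mult_right_zero[symmetric]) (simp add: mult_ac scaleR_conv_of_real)
    ultimately have "g (\<i> * of_real R) - g (- \<i> * of_real R) = \<i> * (LINT w|lborel. indicator {-R..R} w *\<^sub>R ?h w)"
      by simp
    then show ?thesis by (metis complex_i_not_zero nonzero_mult_div_cancel_left)
  qed
  have lim1: "(\<lambda>n. LINT w|lborel. indicator {-real (Suc n)..real (Suc n)} w *\<^sub>R ?h w) \<longlonglongrightarrow> (LINT w|lborel. ?h w)"
  proof (rule integral_dominated_convergence[where w = "\<lambda>w. cmod (?h w)"])
    show "?h \<in> borel_measurable lborel" using int by auto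
    show "(\<lambda>w. indicator {-real (Suc n)..real (Suc n)} w *\<^sub>R ?h w) \<in> borel_measurable lborel" for n
      using int by measurable
    show "integrable lborel (\<lambda>w. cmod (?h w))" using int by auto
    show "AE w in lborel. (\<lambda>n. indicator {-real (Suc n)..real (Suc n)} w *\<^sub>R ?h w) \<longlonglongrightarrow> ?h w"
    proof (rule AE_I2)
      fix w :: real
      obtain m where m: "\<bar>w\<bar> \<le> real m" using real_arch_simple by blast
      have "\<forall>\<^sub>F n in sequentially. indicator {-real (Suc n)..real (Suc n)} w *\<^sub>R ?h w = ?h w"
        using eventually_ge_at_top[of m] by eventually_elim (use m in \<open>auto simp: indicator_def\<close>)
      then show "(\<lambda>n. indicator {-real (Suc n)..real (Suc n)} w *\<^sub>R ?h w) \<longlonglongrightarrow> ?h w"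
        by (rule tendsto_eventually)
    qed
  qed (auto simp: indicator_def)
  have lim2: "(\<lambda>n. LINT w|lborel. indicator {-real (Suc n)..real (Suc n)} w *\<^sub>R ?h w) \<longlonglongrightarrow> 0"
  proof (rule Lim_null_comparison)
    show "\<forall>\<^sub>F n in sequentially. cmod (LINT w|lborel. indicator {-real (Suc n)..real (Suc n)} w *\<^sub>R ?h w) \<le> 6 * C * inverse (real (Suc n))"
    proof (rule always_eventually, rule allI)
      fix n
      show "cmod (LINT w|lborel. indicator {-real (Suc n)..real (Suc n)} w *\<^sub>R ?h w) \<le> 6 * C * inverse (real (Suc n))"
        using g_bound[of "real (Suc n)"] by (subst part) (simp_all add: norm_mult norm_divide divide_inverse)
    qed
    show "(\<lambda>n. 6 * C * inverse (real (Suc n))) \<longlonglongrightarrow> 0"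
      using tendsto_mult_right_zero[OF LIMSEQ_inverse_real_of_nat, of "6 * C"] by simp
  qed
  from LIMSEQ_unique[OF lim1 lim2] show ?thesis by (simp add: f_def)
qed

section \<open>The first variation of a squared L2 distance\<close>

definition L2_line :: "(real \<Rightarrow> complex) \<Rightarrow> bool" where
  "L2_line f \<longleftrightarrow> f \<in> borel_measurable lborel \<and> integrable lborel (\<lambda>w. (cmod (f w))\<^sup>2)"

lemma L2_line_bound:
  assumes "L2_line g" and "f \<in> borel_measurable lborel" and "\<And>w. cmod (f w) \<le> C * cmod (g w)"
  shows "L2_line f"
  unfolding L2_line_def
proof (intro conjI assms(2))
  have [measurable]: "f \<in> borel_measurable lborel" by fact
  have "integrable lborel (\<lambda>w. C\<^sup>2 * (cmod (g w))\<^sup>2)"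
    using assms(1) by (simp add: L2_line_def)
  then show "integrable lborel (\<lambda>w. (cmod (f w))\<^sup>2)"
  proof (rule Bochner_Integration.integrable_bound)
    have "(cmod (f w))\<^sup>2 \<le> C\<^sup>2 * (cmod (g w))\<^sup>2" for w
      using power_mono[OF assms(3)[of w], of 2] by (simp add: power_mult_distrib)
    then show "AE w in lborel. norm ((cmod (f w))\<^sup>2) \<le> norm (C\<^sup>2 * (cmod (g w))\<^sup>2)"
      by simp
  qed simp
qed

lemma L2_line_diff:
  assumes "L2_line f" and "L2_line g"
  shows "L2_line (\<lambda>w. f w - g w)"
  unfolding L2_line_def
proof (intro conjI)
  have [measurable]: "f \<in> borel_measurable lborel" "g \<in> borel_measurable lborel"
    using assms by (auto simp: L2_line_def)
  show "(\<lambda>w. f w - g w) \<in> borel_measurable lborel" by simp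
  have "integrable lborel (\<lambda>w. 2 * (cmod (f w))\<^sup>2 + 2 * (cmod (g w))\<^sup>2)"
    using assms by (simp add: L2_line_def)
  then show "integrable lborel (\<lambda>w. (cmod (f w - g w))\<^sup>2)"
  proof (rule Bochner_Integration.integrable_bound)
    have "(cmod (f w - g w))\<^sup>2 \<le> 2 * (cmod (f w))\<^sup>2 + 2 * (cmod (g w))\<^sup>2" for w
    proof -
      have "(cmod (f w - g w))\<^sup>2 \<le> (cmod (f w) + cmod (g w))\<^sup>2"
        by (intro power_mono norm_triangle_ineq4) auto
      also have "\<dots> \<le> 2 * (cmod (f w))\<^sup>2 + 2 * (cmod (g w))\<^sup>2"
        using zero_le_power2[of "cmod (f w) - cmod (g w)"]
        by (simp add: power2_eq_square algebra_simps)
      finally show ?thesis .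
    qed
    then show "AE w in lborel. norm ((cmod (f w - g w))\<^sup>2)
        \<le> norm (2 * (cmod (f w))\<^sup>2 + 2 * (cmod (g w))\<^sup>2)"
      by simp
  qed simp
qed

lemma integrable_L2_line_norm_mult:
  assumes "L2_line f" and "L2_line g"
  shows "integrable lborel (\<lambda>w. cmod (f w) * cmod (g w))"
proof -
  have [measurable]: "f \<in> borel_measurable lborel" "g \<in> borel_measurable lborel"
    using assms by (auto simp: L2_line_def)
  have "integrable lborel (\<lambda>w. (cmod (f w))\<^sup>2 + (cmod (g w))\<^sup>2)"
    using assms by (simp add: L2_line_def)
  then show ?thesis
  proof (rule Bochner_Integration.integrable_bound)
    have "cmod (f w) * cmod (g w) \<le> (cmod (f w))\<^sup>2 + (cmod (g w))\<^sup>2" for w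
      using zero_le_power2[of "cmod (f w) - cmod (g w)"] mult_nonneg_nonneg[OF norm_ge_zero norm_ge_zero, of "f w" "g w"]
      unfolding power2_diff mult.assoc by linarith
    then show "AE w in lborel. norm (cmod (f w) * cmod (g w)) \<le> norm ((cmod (f w))\<^sup>2 + (cmod (g w))\<^sup>2)"
      by simp
  qed simp
qed

lemma integrable_L2_line_mult_cnj:
  assumes "L2_line f" and "L2_line g"
  shows "integrable lborel (\<lambda>w. f w * cnj (g w))"
proof -
  have [measurable]: "f \<in> borel_measurable lborel" "g \<in> borel_measurable lborel"
    using assms by (auto simp: L2_line_def)
  have "(\<lambda>w. cnj (g w)) \<in> borel_measurable lborel"
    by (rule borel_measurable_continuous_on[where f = cnj]) (auto intro!: continuous_intros)
  then have "(\<lambda>w. f w * cnj (g w)) \<in> borel_measurable lborel" by simp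
  then show ?thesis
    by (rule Bochner_Integration.integrable_bound[OF integrable_L2_line_norm_mult[OF assms]])
      (simp add: norm_mult)
qed

lemma L2_line_rat:
  assumes "hurwitz a" and "degree b < degree a"
  shows "L2_line (rat_at_iw b a)"
proof -
  have roots: "Re z < 0" if "poly (cpoly a) z = 0" for z
    using assms(1) that by (auto simp: hurwitz_def)
  have meas: "rat_at_iw b a \<in> borel_measurable lborel"
    using borel_measurable_rational_ii[of "cpoly a" "cpoly b"] roots
    by (simp add: rat_at_iw_def[abs_def])
  have "degree (cpoly b) + 1 \<le> degree (cpoly a)"
    using assms(2) by (simp add: degree_map_poly)
  then obtain C where C: "C \<ge> 0" "\<And>s. 0 \<le> Re s \<Longrightarrow>
      cmod (poly (cpoly b) s / poly (cpoly a) s) \<le> C / cmod (1 + s) ^ 1"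
    using rhp_rational_decay[of "cpoly a" "cpoly b" 1] roots by blast
  have "(cmod (rat_at_iw b a w))\<^sup>2 \<le> C\<^sup>2 / (1 + w\<^sup>2)" for w
    using power_mono[OF C(2)[of "\<i> * of_real w"], of 2]
    by (simp add: rat_at_iw_def power_divide cmod_1_plus_ii)
  then have "integrable lborel (\<lambda>w. (cmod (rat_at_iw b a w))\<^sup>2)"
    by (intro Bochner_Integration.integrable_bound[OF integrable_const_over_1_plus_square[of "C\<^sup>2"]])
      (use meas in auto)
  with meas show ?thesis by (simp add: L2_line_def)
qed

lemma cmod_diff_sq: "(cmod (x - y))\<^sup>2 = (cmod x)\<^sup>2 - 2 * Re (x * cnj y) + (cmod y)\<^sup>2"
  unfolding cmod_power2 by (simp add: power2_eq_square algebra_simps)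

text \<open>A quadratic remainder with an explicit constant takes the place of differentiation under
  the integral. The quotient k/(1 + t c) is the exact change of a fraction when its numerator and
  denominator move linearly in t; \<open>t * C\<close> being at most 1/2 in modulus keeps its
  denominator away from 0.\<close>

lemma L2_line_first_variation:
  fixes E k c :: "real \<Rightarrow> complex" and t C :: real
  assumes E: "L2_line E" and k: "L2_line k" and c: "c \<in> borel_measurable lborel"
    and C: "\<And>w. cmod (c w) \<le> C" and t: "\<bar>t\<bar> * C \<le> 1/2"
  shows "\<bar>(LINT w|lborel. (cmod (E w - of_real t * (k w / (1 + of_real t * c w))))\<^sup>2)
       - (LINT w|lborel. (cmod (E w))\<^sup>2) + 2 * t * (LINT w|lborel. Re (E w * cnj (k w)))\<bar>
     \<le> t\<^sup>2 * (LINT w|lborel. 4 * C * (cmod (E w) * cmod (k w)) + 4 * (cmod (k w))\<^sup>2)"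
proof -
  have [measurable]: "E \<in> borel_measurable lborel" "k \<in> borel_measurable lborel" "c \<in> borel_measurable lborel"
    using E k c by (auto simp: L2_line_def)
  define q where "q = (\<lambda>w. k w / (1 + of_real t * c w))"
  have half: "1/2 \<le> cmod (1 + of_real t * c w)" for w
  proof -
    have "cmod (of_real t * c w) \<le> \<bar>t\<bar> * C"
      using C[of w] by (simp add: norm_mult mult_left_mono)
    then show ?thesis
      using norm_diff_ineq[of 1 "of_real t * c w"] t by simp
  qed
  have q_bound: "cmod (q w) \<le> 2 * cmod (k w)" for w
  proof -
    have "cmod (k w) * 1 \<le> cmod (k w) * (2 * cmod (1 + of_real t * c w))"
      using half[of w] by (intro mult_left_mono) auto
    moreover have "cmod (1 + of_real t * c w) > 0" using half[of w] by linarith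
    ultimately show ?thesis
      unfolding q_def norm_divide by (simp add: field_simps)
  qed
  have [measurable]: "q \<in> borel_measurable lborel" unfolding q_def by simp
  have q: "L2_line q" by (rule L2_line_bound[OF k _ q_bound]) simp
  have tq: "L2_line (\<lambda>w. of_real t * q w)"
    by (rule L2_line_bound[OF q, where C = "\<bar>t\<bar>"]) (auto simp: norm_mult)
  \<comment> \<open>The exact quotient q differs from k by t c q, so putting k in its place in the
    linear term costs only order t^2.\<close>
  have kq: "cmod (k w - q w) \<le> 2 * C * \<bar>t\<bar> * cmod (k w)" for w
  proof -
    have "1 + of_real t * c w \<noteq> 0" using half[of w] by force
    then have "k w - q w = of_real t * c w * q w"
      by (simp add: q_def field_simps)
    then have "cmod (k w - q w) = \<bar>t\<bar> * (cmod (c w) * cmod (q w))" by (simp add: norm_mult)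
    also have "\<dots> \<le> \<bar>t\<bar> * (C * (2 * cmod (k w)))"
      using C[of w] q_bound[of w] order_trans[OF norm_ge_zero C[of w]]
      by (intro mult_left_mono mult_mono) auto
    finally show ?thesis by (simp add: mult_ac)
  qed
  have pw: "\<bar>(cmod (E w - of_real t * q w))\<^sup>2 - (cmod (E w))\<^sup>2 + 2 * t * Re (E w * cnj (k w))\<bar>
      \<le> t\<^sup>2 * (4 * C * (cmod (E w) * cmod (k w)) + 4 * (cmod (k w))\<^sup>2)" for w
  proof -
    have "(cmod (E w - of_real t * q w))\<^sup>2 - (cmod (E w))\<^sup>2 + 2 * t * Re (E w * cnj (k w))
        = 2 * t * Re (E w * cnj (k w - q w)) + t\<^sup>2 * (cmod (q w))\<^sup>2"
      unfolding cmod_diff_sq by (simp add: norm_mult power_mult_distrib algebra_simps)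
    also have "\<bar>\<dots>\<bar> \<le> 2 * \<bar>t\<bar> * \<bar>Re (E w * cnj (k w - q w))\<bar> + t\<^sup>2 * (cmod (q w))\<^sup>2"
      by (rule order_trans[OF abs_triangle_ineq]) (simp add: abs_mult)
    also have "\<dots> \<le> 2 * \<bar>t\<bar> * (cmod (E w) * (2 * C * \<bar>t\<bar> * cmod (k w))) + t\<^sup>2 * (2 * cmod (k w))\<^sup>2"
    proof (intro add_mono mult_left_mono power_mono q_bound)
      have "\<bar>Re (E w * cnj (k w - q w))\<bar> \<le> cmod (E w) * cmod (k w - q w)"
        by (metis abs_Re_le_cmod complex_mod_cnj norm_mult)
      also have "\<dots> \<le> cmod (E w) * (2 * C * \<bar>t\<bar> * cmod (k w))"
        by (intro mult_left_mono kq) auto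
      finally show "\<bar>Re (E w * cnj (k w - q w))\<bar> \<le> cmod (E w) * (2 * C * \<bar>t\<bar> * cmod (k w))" .
    qed auto
    also have "\<dots> = t\<^sup>2 * (4 * C * (cmod (E w) * cmod (k w)) + 4 * (cmod (k w))\<^sup>2)"
    proof -
      have "t\<^sup>2 = \<bar>t\<bar> * \<bar>t\<bar>" by (simp add: power2_eq_square)
      then show ?thesis by (simp add: power_mult_distrib algebra_simps)
    qed
    finally show ?thesis .
  qed
  have i1: "integrable lborel (\<lambda>w. (cmod (E w - of_real t * q w))\<^sup>2)"
    using L2_line_diff[OF E tq] by (simp add: L2_line_def)
  have i2: "integrable lborel (\<lambda>w. (cmod (E w))\<^sup>2)" "integrable lborel (\<lambda>w. (cmod (k w))\<^sup>2)"
    using E k by (auto simp: L2_line_def)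
  have i3: "integrable lborel (\<lambda>w. Re (E w * cnj (k w)))"
    by (rule integrable_Re[OF integrable_L2_line_mult_cnj[OF E k]])
  have i4: "integrable lborel (\<lambda>w. cmod (E w) * cmod (k w))"
    by (rule integrable_L2_line_norm_mult[OF E k])
  have "(LINT w|lborel. (cmod (E w - of_real t * q w))\<^sup>2)
       - (LINT w|lborel. (cmod (E w))\<^sup>2) + 2 * t * (LINT w|lborel. Re (E w * cnj (k w)))
      = (LINT w|lborel. (cmod (E w - of_real t * q w))\<^sup>2 - (cmod (E w))\<^sup>2 + 2 * t * Re (E w * cnj (k w)))"
    using i1 i2 i3 by (simp del: times_complex.sel complex_cnj)
  also have "\<bar>\<dots>\<bar> \<le> (LINT w|lborel. t\<^sup>2 * (4 * C * (cmod (E w) * cmod (k w)) + 4 * (cmod (k w))\<^sup>2))"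
    unfolding real_norm_def[symmetric]
    by (rule Bochner_Integration.integral_norm_bound_integral) (use i1 i2 i3 i4 pw in \<open>auto simp del: times_complex.sel\<close>)
  also have "\<dots> = t\<^sup>2 * (LINT w|lborel. 4 * C * (cmod (E w) * cmod (k w)) + 4 * (cmod (k w))\<^sup>2)"
    by (rule integral_mult_right_zero)
  finally show ?thesis unfolding q_def .
qed

section \<open>Orthogonality at a critical point\<close>

lemma cpoly_add: "cpoly (p + q) = cpoly p + cpoly q"
  and cpoly_minus: "cpoly (- p) = - cpoly p"
  and cpoly_diff: "cpoly (p - q) = cpoly p - cpoly q"
  and cpoly_mult: "cpoly (p * q) = cpoly p * cpoly q"
  and cpoly_smult: "cpoly (Polynomial.smult c p) = Polynomial.smult (of_real c) (cpoly p)"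
  by (simp_all add: poly_eq_iff coeff_map_poly coeff_mult)

lemma cpoly_pCons: "cpoly (pCons c p) = pCons (of_real c) (cpoly p)"
  by (simp add: poly_eq_iff coeff_map_poly coeff_pCons split: nat.split)

lemma cpoly_power: "cpoly (p ^ n) = cpoly p ^ n"
  by (induction n) (simp_all add: cpoly_mult)

lemma cpoly_eq_iff: "cpoly p = cpoly q \<longleftrightarrow> p = q"
  by (simp add: poly_eq_iff coeff_map_poly)

lemma degree_cpoly: "degree (cpoly p) = degree p"
  by (simp add: degree_map_poly)

lemma poly_cpoly_cnj: "poly (cpoly p) (cnj z) = cnj (poly (cpoly p) z)"
  by (rule poly_cnj_real[symmetric]) (simp add: coeff_map_poly)

abbreviation (input) refl_poly :: "real poly \<Rightarrow> real poly" where
  "refl_poly p \<equiv> p \<circ>\<^sub>p [:0, -1:]"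

lemma poly_cpoly_refl: "poly (cpoly (refl_poly p)) z = poly (cpoly p) (- z)"
  by (induction p) (simp_all add: pcompose_pCons cpoly_pCons cpoly_minus)

text \<open>This turns the conjugate in an inner product into a polynomial value, so that Cauchy's
  theorem can be applied.\<close>

lemma poly_cpoly_refl_ii:
  "poly (cpoly (refl_poly p)) (\<i> * of_real w) = cnj (poly (cpoly p) (\<i> * of_real w))"
  by (simp add: poly_cpoly_refl flip: poly_cpoly_cnj)

lemma degree_refl_poly [simp]: "degree (refl_poly p) = degree p"
  by (simp add: degree_pcompose)

lemma hurwitz_mult: "hurwitz a \<Longrightarrow> hurwitz b \<Longrightarrow> hurwitz (a * b)"
  by (auto simp: hurwitz_def cpoly_mult)

lemma hurwitz_power: "hurwitz a \<Longrightarrow> hurwitz (a ^ n)"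
  by (auto simp: hurwitz_def cpoly_power)

lemma hurwitz_nonzero: "hurwitz a \<Longrightarrow> a \<noteq> 0"
  using spec[of "\<lambda>z. poly (cpoly a) z = 0 \<longrightarrow> Re z < 0" 0] by (auto simp: hurwitz_def)

lemma hurwitz_ii_nonzero: "hurwitz a \<Longrightarrow> poly (cpoly a) (\<i> * of_real w) \<noteq> 0"
  by (auto simp: hurwitz_def)

text \<open>A common factor of positive degree would have a complex zero lying in the open left and
  in the open right half plane.\<close>

lemma coprime_hurwitz_refl:
  assumes "hurwitz a" and "hurwitz c"
  shows "coprime c (refl_poly a)"
proof (rule coprimeI)
  fix g assume g: "g dvd c" "g dvd refl_poly a"
  have "g \<noteq> 0" using g(1) hurwitz_nonzero[OF assms(2)] by auto
  moreover have "degree g = 0"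
  proof (rule ccontr)
    assume "degree g \<noteq> 0"
    then have "\<not> constant (poly (cpoly g))" by (simp add: constant_degree degree_cpoly)
    then obtain z where z: "poly (cpoly g) z = 0"
      using fundamental_theorem_of_algebra by blast
    have "poly (cpoly c) z = 0" "poly (cpoly (refl_poly a)) z = 0"
      using g z by (auto simp: dvd_def cpoly_mult)
    then have "Re z < 0" "Re (- z) < 0"
      using assms unfolding hurwitz_def poly_cpoly_refl by blast+
    then show False by simp
  qed
  ultimately show "is_unit g" by (simp add: is_unit_iff_degree)
qed

text \<open>In a Bezout representation the coefficient of \<open>b\<close> is reduced modulo
  \<open>a\<close>; the degree of \<open>x\<close> is then forced by x a = p - y b. It serves twice:
  to decompose the numerator of the error, and to write a given p as the numerator of a tangent
  vector at b/a.\<close>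

lemma coprime_poly_decomp:
  fixes a b p :: "'a::field_gcd poly"
  assumes "coprime a b" and "0 < degree a" and "0 < m"
    and "degree b \<le> m" and "degree p < degree a + m"
  obtains x y where "p = x * a + y * b" "degree y < degree a" "degree x < m"
proof -
  obtain u v where uv: "u * a + v * b = 1"
    using assms(1) bezout_coefficients_fst_snd[of a b] by auto
  define y where "y = (p * v) mod a"
  define x where "x = p * u + (p * v div a) * b"
  have "x * a + y * b = p * (u * a) + (p * v div a * a + y) * b"
    by (simp add: x_def algebra_simps)
  also have "p * v div a * a + y = p * v" by (simp add: y_def)
  also have "p * (u * a) + p * v * b = p * (u * a + v * b)" by (simp add: algebra_simps)
  finally have eq: "p = x * a + y * b" using uv by simp
  have dy: "degree y < degree a"
    unfolding y_def using assms(2) degree_mod_less[of a "p * v"] by fastforce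
  have "degree (y * b) < degree a + m"
    using degree_mult_le[of y b] dy assms(4) by linarith
  then have "degree (p - y * b) < degree a + m"
    using assms(5) by (rule degree_diff_less[rotated])
  then have xa: "degree (x * a) < degree a + m" by (simp add: eq)
  have "degree x < m"
  proof (cases "x = 0")
    case False
    then show ?thesis using xa assms(2) by (subst (asm) degree_mult_eq) auto
  qed (use assms(3) in simp)
  with that eq dy show ?thesis by blast
qed

section \<open>The first-order condition in the coefficient chart\<close>

lemma coeff_norm_nonneg: "coeff_norm p \<ge> 0"
  by (simp add: coeff_norm_def sum_nonneg)

lemma coeff_norm_smult: "coeff_norm (Polynomial.smult t p) = \<bar>t\<bar> * coeff_norm p"
  by (cases "t = 0") (simp_all add: coeff_norm_def abs_mult sum_distrib_left)

text \<open>The identity is exact in t: the tangent vector (v A - B u)/A^2 appears divided by 1 + t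
  u/A, which is the shape \<open>L2_line_first_variation\<close> handles.\<close>

lemma fraction_perturbation:
  fixes A B u v t :: "'a::field"
  assumes "A \<noteq> 0" and "A + t * u \<noteq> 0"
  shows "(B + t * v) / (A + t * u) = B / A + t * ((v * A - B * u) / A\<^sup>2 / (1 + t * (u / A)))"
proof -
  have "1 + t * (u / A) = (A + t * u) / A" using assms(1) by (simp add: field_simps)
  then have "B / A + t * ((v * A - B * u) / A\<^sup>2 / (1 + t * (u / A)))
      = B / A + t * (v * A - B * u) / (A * (A + t * u))"
    using assms(1) by (simp add: power2_eq_square)
  also have "\<dots> = (B * (A + t * u) + t * (v * A - B * u)) / (A * (A + t * u))"
    using assms by (simp add: add_divide_distrib)
  also have "\<dots> = (B + t * v) * A / (A * (A + t * u))"
    by (simp add: algebra_simps)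
  finally show ?thesis using assms(1) by simp
qed

text \<open>Along (t \<alpha>, t \<beta>) the squared distance, before the factor 1/(2 pi), changes
  by -2 t I up to order t^2, whereas criticality allows only a multiple of \<epsilon> t. A small
  \<epsilon> and then a small t contradict a nonzero I.\<close>

lemma critical_point_first_order:
  assumes crit: "critical_point (H2_err_sq e d) n b a"
    and d: "hurwitz d" and e: "degree e < degree d"
    and \<alpha>: "degree \<alpha> < n" and \<beta>: "degree \<beta> < n"
  shows "(LINT w|lborel. Re ((rat_at_iw e d w - rat_at_iw b a w)
           * cnj (rat_at_iw (\<beta> * a - b * \<alpha>) (a\<^sup>2) w))) = 0" (is "?I = 0")
proof (rule ccontr)
  assume I: "?I \<noteq> 0"
  have a: "degree a = n" "hurwitz a" and b: "degree b < n"
    using crit by (auto simp: critical_point_def SigmaS_def)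
  define E where "E = (\<lambda>w. rat_at_iw e d w - rat_at_iw b a w)"
  define k where "k = rat_at_iw (\<beta> * a - b * \<alpha>) (a\<^sup>2)"
  define c where "c = rat_at_iw \<alpha> a"
  have E: "L2_line E"
    unfolding E_def using a b d e by (intro L2_line_diff L2_line_rat) auto
  have "degree (\<beta> * a - b * \<alpha>) < degree (a\<^sup>2)"
  proof (rule degree_diff_less)
    show "degree (\<beta> * a) < degree (a\<^sup>2)"
      using degree_mult_le[of \<beta> a] a \<beta> by (simp add: degree_power_eq hurwitz_nonzero)
    show "degree (b * \<alpha>) < degree (a\<^sup>2)"
      using degree_mult_le[of b \<alpha>] a \<alpha> b by (simp add: degree_power_eq hurwitz_nonzero)
  qed
  then have k: "L2_line k"
    unfolding k_def using a by (intro L2_line_rat hurwitz_power) auto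
  have c: "c \<in> borel_measurable lborel"
    using L2_line_rat[of a \<alpha>] a \<alpha> by (simp add: c_def L2_line_def)
  have "degree (cpoly \<alpha>) \<le> degree (cpoly a)" using \<alpha> a by (simp add: degree_cpoly)
  then obtain C where C: "C \<ge> 0"
    "\<And>s. 0 \<le> Re s \<Longrightarrow> cmod (poly (cpoly \<alpha>) s) \<le> C * cmod (poly (cpoly a) s)"
    using rhp_poly_bound[of "cpoly a" "cpoly \<alpha>"] a by (auto simp: hurwitz_def)
  have cC: "cmod (c w) \<le> C" for w
    using C(2)[of "\<i> * of_real w"] hurwitz_ii_nonzero[OF a(2), of w]
    by (simp add: c_def rat_at_iw_def norm_divide field_simps)
  define K where "K = coeff_norm \<alpha> + coeff_norm \<beta>"
  have K: "K \<ge> 0" by (simp add: K_def coeff_norm_nonneg)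
  define J where "J = (LINT w|lborel. 4 * C * (cmod (E w) * cmod (k w)) + 4 * (cmod (k w))\<^sup>2)"
  define I where "I = ?I"
  \<comment> \<open>Chosen so that \<open>2 * pi * \<epsilon> * K\<close> is at most \<bar>I\<bar>;
    K + 1 guards against K = 0.\<close>
  define \<epsilon> where "\<epsilon> = \<bar>I\<bar> / (2 * pi * (K + 1))"
  have "\<epsilon> > 0" using I K by (simp add: \<epsilon>_def I_def)
  then obtain \<delta> where \<delta>: "\<delta> > 0" and fr: "\<And>\<alpha> \<beta>. degree \<alpha> < n \<Longrightarrow> degree \<beta> < n \<Longrightarrow>
        coeff_norm \<alpha> + coeff_norm \<beta> < \<delta> \<Longrightarrow>
        \<bar>H2_err_sq e d (b + \<beta>) (a + \<alpha>) - H2_err_sq e d b a\<bar> \<le> \<epsilon> * (coeff_norm \<alpha> + coeff_norm \<beta>)"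
    using crit unfolding critical_point_def by meson
  \<comment> \<open>The three bounds put the perturbation inside the \<delta>-neighbourhood, secure
    the hypothesis on t of the first variation, and push the remainder t J below
    \<bar>I\<bar>.\<close>
  define t where "t = min (\<delta> / (2 * (K + 1))) (min (1 / (2 * (C + 1))) (\<bar>I\<bar> / (2 * (\<bar>J\<bar> + 1))))"
  have t: "t > 0" using \<delta> K C I by (simp add: t_def I_def)
  have "t * (2 * (K + 1)) \<le> \<delta>" "t * (2 * (C + 1)) \<le> 1" "t * (2 * (\<bar>J\<bar> + 1)) \<le> \<bar>I\<bar>"
    using K C by (simp_all add: t_def min_le_iff_disj flip: pos_le_divide_eq)
  then have tK: "t * K < \<delta>" and tC: "\<bar>t\<bar> * C \<le> 1/2" and tJ: "t * \<bar>J\<bar> < \<bar>I\<bar>"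
    using t mult_nonneg_nonneg[OF less_imp_le[OF t] K] mult_nonneg_nonneg[OF less_imp_le[OF t] abs_ge_zero, of J]
    unfolding distrib_left mult.left_commute[of t 2] by (simp_all only: abs_of_pos)
  have rat: "rat_at_iw e d w - rat_at_iw (b + Polynomial.smult t \<beta>) (a + Polynomial.smult t \<alpha>) w
      = E w - of_real t * (k w / (1 + of_real t * c w))" for w
  proof -
    let ?z = "\<i> * of_real w :: complex"
    have nz: "poly (cpoly a) ?z \<noteq> 0" by (rule hurwitz_ii_nonzero[OF a(2)])
    have "cmod (of_real t * c w) \<le> \<bar>t\<bar> * C"
      using cC[of w] by (simp add: norm_mult mult_left_mono)
    \<comment> \<open>The smallness of t also keeps the perturbed denominator a + t \<alpha> free of
      zeros on the axis.\<close>
    then have "1 + of_real t * c w \<noteq> 0"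
      using tC norm_diff_ineq[of 1 "of_real t * c w"] by auto
    then have "poly (cpoly a) ?z + of_real t * poly (cpoly \<alpha>) ?z \<noteq> 0"
      using nz by (auto simp: c_def rat_at_iw_def field_simps)
    from fraction_perturbation[OF nz this] show ?thesis
      by (simp add: E_def k_def c_def rat_at_iw_def cpoly_add cpoly_diff cpoly_mult cpoly_smult cpoly_power)
  qed
  let ?F = "\<lambda>t. LINT w|lborel. (cmod (E w - of_real t * (k w / (1 + of_real t * c w))))\<^sup>2"
  have F: "H2_err_sq e d (b + Polynomial.smult t \<beta>) (a + Polynomial.smult t \<alpha>) = 1 / (2 * pi) * ?F t"
    unfolding H2_err_sq_def rat ..
  have F0: "H2_err_sq e d b a = 1 / (2 * pi) * (LINT w|lborel. (cmod (E w))\<^sup>2)"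
    unfolding H2_err_sq_def E_def ..
  have "\<bar>H2_err_sq e d (b + Polynomial.smult t \<beta>) (a + Polynomial.smult t \<alpha>) - H2_err_sq e d b a\<bar>
      \<le> \<epsilon> * (coeff_norm (Polynomial.smult t \<alpha>) + coeff_norm (Polynomial.smult t \<beta>))"
    by (rule fr) (use \<alpha> \<beta> tK t in \<open>auto simp: coeff_norm_smult K_def algebra_simps\<close>)
  also have "\<dots> = \<epsilon> * t * K"
    using t by (simp add: coeff_norm_smult K_def algebra_simps)
  finally have "\<bar>?F t - (LINT w|lborel. (cmod (E w))\<^sup>2)\<bar> / (2 * pi) \<le> \<epsilon> * t * K"
    unfolding F F0 by (simp add: diff_divide_distrib[symmetric])
  then have "\<bar>?F t - (LINT w|lborel. (cmod (E w))\<^sup>2)\<bar> \<le> t * (2 * pi * \<epsilon> * K)"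
    by (simp add: field_simps)
  moreover have "\<bar>?F t - (LINT w|lborel. (cmod (E w))\<^sup>2) + 2 * t * I\<bar> \<le> t\<^sup>2 * J"
    using L2_line_first_variation[OF E k c cC tC] unfolding J_def I_def E_def k_def .
  ultimately have "\<bar>2 * t * I\<bar> \<le> t\<^sup>2 * J + t * (2 * pi * \<epsilon> * K)" by linarith
  then have "t * (2 * \<bar>I\<bar>) \<le> t * (t * J + 2 * pi * \<epsilon> * K)"
    using t by (simp add: abs_mult power2_eq_square algebra_simps)
  then have "2 * \<bar>I\<bar> \<le> t * J + 2 * pi * \<epsilon> * K" using t by simp
  moreover have "2 * pi * \<epsilon> * K \<le> \<bar>I\<bar>"
  proof -
    have "2 * pi * \<epsilon> * K = \<bar>I\<bar> * (K / (K + 1))"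
      by (simp add: \<epsilon>_def)
    also have "\<dots> \<le> \<bar>I\<bar>" using K by (intro mult_left_le) auto
    finally show ?thesis .
  qed
  moreover have "t * J < \<bar>I\<bar>"
    using tJ mult_left_mono[OF abs_ge_self less_imp_le[OF t], of J] by linarith
  ultimately show False by linarith
qed

lemma critical_point_refl_dvd:
  assumes crit: "critical_point (H2_err_sq e d) n b a"
    and d: "hurwitz d" and e: "degree e < degree d" and n: "0 < n"
  shows "(refl_poly a)\<^sup>2 dvd e * a - b * d"
proof -
  have a: "degree a = n" "hurwitz a" and b: "degree b < n" and cop: "coprime a b"
    using crit by (auto simp: critical_point_def SigmaS_def)
  have nz: "a \<noteq> 0" "d \<noteq> 0" using a d hurwitz_nonzero by blast+
  define r where "r = e * a - b * d"
  have deg_da: "degree (d * a) = degree d + n" using nz a by (simp add: degree_mult_eq)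
  have deg_ra: "degree ((refl_poly a)\<^sup>2) = 2 * n"
    using nz a by (subst degree_power_eq) (auto dest: pcompose_eq_0)
  have "degree r < degree d + n"
    unfolding r_def
  proof (rule degree_diff_less)
    show "degree (e * a) < degree d + n" using degree_mult_le[of e a] e a by linarith
    show "degree (b * d) < degree d + n" using degree_mult_le[of b d] b by linarith
  qed
  then have deg_r: "degree (r * a\<^sup>2) < degree ((refl_poly a)\<^sup>2) + (degree d + n)"
    using degree_mult_le[of r "a\<^sup>2"] nz a unfolding deg_ra by (simp add: degree_power_eq)
  have "coprime ((refl_poly a)\<^sup>2) (d * a)"
    using coprime_hurwitz_refl[OF a(2) hurwitz_mult[OF d a(2)]] by (simp add: coprime_commute)
  \<comment> \<open>The degree of r a^2 is below 2n + (deg d + n), the sum of the degrees of a*^2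
    and d a, so both coefficients can be kept in range.\<close>
  then obtain h p where hp: "r * a\<^sup>2 = h * (refl_poly a)\<^sup>2 + p * (d * a)"
    and deg_p: "degree p < degree ((refl_poly a)\<^sup>2)" and deg_h: "degree h < degree d + n"
    by (rule coprime_poly_decomp[OF _ _ _ _ deg_r]) (use n deg_ra deg_da in auto)
  have "degree p < degree a + n" using deg_p deg_ra a by simp
  then obtain x y where xy: "p = x * a + y * b" "degree y < n" "degree x < n"
    using coprime_poly_decomp[OF cop, of n p] a b n by auto
  \<comment> \<open>With \<alpha> = -y and \<beta> = x the tangent vector is p/a^2, so the error is
    tested against its own summand.\<close>
  have p: "p = x * a - b * (- y)" using xy by simp
  let ?E = "\<lambda>w. rat_at_iw e d w - rat_at_iw b a w"
  let ?P = "rat_at_iw p (a\<^sup>2)"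
  let ?Q = "\<lambda>w. poly (cpoly (h * refl_poly p)) (\<i> * of_real w) / poly (cpoly (d * a ^ 3)) (\<i> * of_real w)"
  have zero: "(LINT w|lborel. Re (?E w * cnj (?P w))) = 0"
    using critical_point_first_order[OF crit d e, of "- y" x] xy p by simp
  \<comment> \<open>The factor a*^2 in the other summand cancels the denominator of
    \<open>cnj (?P w)\<close>, which is p*/a*^2 on the axis; what remains has the Hurwitz
    denominator d a^3.\<close>
  have split: "?E w * cnj (?P w) = of_real ((cmod (?P w))\<^sup>2) + ?Q w" for w
  proof -
    let ?z = "\<i> * of_real w :: complex"
    have nz: "poly (cpoly a) ?z \<noteq> 0" "poly (cpoly d) ?z \<noteq> 0"
      using hurwitz_ii_nonzero a d by auto
    have "poly (cpoly (r * a\<^sup>2)) ?z = poly (cpoly (h * (refl_poly a)\<^sup>2 + p * (d * a))) ?z"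
      by (simp only: hp)
    then have hpz: "poly (cpoly r) ?z * (poly (cpoly a) ?z)\<^sup>2
        = poly (cpoly h) ?z * (cnj (poly (cpoly a) ?z))\<^sup>2 + poly (cpoly p) ?z * (poly (cpoly d) ?z * poly (cpoly a) ?z)"
      by (simp only: cpoly_mult cpoly_add cpoly_power poly_mult poly_add poly_power poly_cpoly_refl_ii)
    have "?E w = poly (cpoly r) ?z / (poly (cpoly d) ?z * poly (cpoly a) ?z)"
      using nz by (simp add: rat_at_iw_def r_def cpoly_diff cpoly_mult field_simps)
    also have "\<dots> = poly (cpoly r) ?z * (poly (cpoly a) ?z)\<^sup>2 / (poly (cpoly d) ?z * poly (cpoly a) ?z ^ 3)"
      using nz by (simp add: field_simps power2_eq_square power3_eq_cube)
    also have "\<dots> = poly (cpoly h) ?z * (cnj (poly (cpoly a) ?z))\<^sup>2 / (poly (cpoly d) ?z * poly (cpoly a) ?z ^ 3)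
        + poly (cpoly p) ?z / (poly (cpoly a) ?z)\<^sup>2"
      unfolding hpz using nz by (simp add: field_simps power2_eq_square power3_eq_cube)
    finally have Ew: "?E w = poly (cpoly h) ?z * (cnj (poly (cpoly a) ?z))\<^sup>2 / (poly (cpoly d) ?z * poly (cpoly a) ?z ^ 3) + ?P w"
      by (simp add: rat_at_iw_def cpoly_power)
    have Pw: "cnj (?P w) = cnj (poly (cpoly p) ?z) / (cnj (poly (cpoly a) ?z))\<^sup>2"
      by (simp add: rat_at_iw_def cpoly_power)
    have "?Q w = poly (cpoly h) ?z * (cnj (poly (cpoly a) ?z))\<^sup>2 / (poly (cpoly d) ?z * poly (cpoly a) ?z ^ 3) * cnj (?P w)"
      unfolding Pw cpoly_mult cpoly_power poly_mult poly_power poly_cpoly_refl_ii using nz by simp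
    moreover have "?P w * cnj (?P w) = of_real ((cmod (?P w))\<^sup>2)"
      by (rule complex_norm_square[symmetric])
    ultimately show ?thesis unfolding Ew distrib_right by simp
  qed
  have hur: "hurwitz (d * a ^ 3)" using a d by (intro hurwitz_mult hurwitz_power)
  have roots: "Re z < 0" if "poly (cpoly (d * a ^ 3)) z = 0" for z
    using hur that by (auto simp: hurwitz_def)
  \<comment> \<open>From deg h \<le> deg d + n - 1 and deg p \<le> 2n - 1 the numerator has degree
    at most deg d + 3n - 2: just the gap that Cauchy's theorem requires.\<close>
  have "degree (h * refl_poly p) + 2 \<le> degree (d * a ^ 3)"
    using degree_mult_le[of h "refl_poly p"] deg_h deg_p deg_ra nz a
    by (simp add: degree_mult_eq degree_power_eq)
  then have degQ: "degree (cpoly (h * refl_poly p)) + 2 \<le> degree (cpoly (d * a ^ 3))"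
    unfolding degree_cpoly .
  have Q: "integrable lborel ?Q" "(LINT w|lborel. ?Q w) = 0"
    using integrable_rational_ii[OF roots degQ] integral_rational_ii_eq_0[OF roots degQ] by auto
  have L2P: "L2_line ?P"
    using a deg_p deg_ra nz by (intro L2_line_rat hurwitz_power) (simp_all add: degree_power_eq)
  then have P: "integrable lborel (\<lambda>w. (cmod (?P w))\<^sup>2)" by (simp add: L2_line_def)
  have "0 = (LINT w|lborel. (cmod (?P w))\<^sup>2 + Re (?Q w))"
    using zero unfolding split by (simp only: plus_complex.sel Re_complex_of_real)
  also have "\<dots> = (LINT w|lborel. (cmod (?P w))\<^sup>2) + (LINT w|lborel. Re (?Q w))"
    by (rule Bochner_Integration.integral_add[OF P integrable_Re[OF Q(1)]])
  also have "(LINT w|lborel. Re (?Q w)) = 0"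
    using integral_Re[OF Q(1)] Q(2) by simp
  finally have "(LINT w|lborel. (cmod (?P w))\<^sup>2) = 0" by simp
  then have AE: "AE w in lborel. ?P w = 0"
    using integral_nonneg_eq_0_iff_AE[OF P] by simp
  \<comment> \<open>A nonzero p has finitely many zeros on the axis, a null set, so vanishing almost
    everywhere would make the whole line null.\<close>
  have "p = 0"
  proof (rule ccontr)
    assume "p \<noteq> 0"
    then have "cpoly p \<noteq> 0" using cpoly_eq_iff[of p 0] by simp
    then have "finite {z. poly (cpoly p) z = 0}" by (rule poly_roots_finite)
    then have "finite ((\<lambda>w::real. \<i> * of_real w) -` {z. poly (cpoly p) z = 0})"
      by (rule finite_vimageI) (auto simp: inj_def)
    then have "AE w in lborel. w \<notin> (\<lambda>w::real. \<i> * of_real w) -` {z. poly (cpoly p) z = 0}"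
      by (intro AE_not_in finite_imp_null_set_lborel)
    with AE have "AE w in (lborel :: real measure). False"
      by eventually_elim (use hurwitz_ii_nonzero[OF a(2)] in \<open>auto simp: rat_at_iw_def cpoly_power\<close>)
    then have "emeasure (lborel :: real measure) UNIV = 0"
      by (simp add: AE_iff_measurable[OF _ refl])
    then show False by simp
  qed
  then have "(refl_poly a)\<^sup>2 dvd r * a\<^sup>2" using hp by simp
  moreover have "coprime ((refl_poly a)\<^sup>2) (a\<^sup>2)"
    using coprime_hurwitz_refl[OF a(2) a(2)] by (simp add: coprime_commute[of a])
  ultimately show ?thesis
    unfolding r_def[symmetric] using coprime_dvd_mult_left_iff by blast
qed

section \<open>The quadratic system\<close>

lemma sum_fun_apply: "(\<Sum>j\<in>A. F j) x = (\<Sum>j\<in>A. F j x)"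
  for F :: "'i \<Rightarrow> 'p \<Rightarrow> 'b::comm_monoid_add"
  by (induction A rule: infinite_finite_induct) auto

text \<open>Modulo the equations, the square-free monomials span the functions on the solution set:
  a factor occurring twice is replaced by a linear form, which lowers the degree.\<close>

lemma quadratic_system_card_le:
  fixes X :: "nat \<Rightarrow> 'p \<Rightarrow> 'a::field" and M :: "nat \<Rightarrow> nat \<Rightarrow> 'a"
  assumes fin: "finite S"
    and eq: "\<And>x i. x \<in> S \<Longrightarrow> i < N \<Longrightarrow> (X i x)\<^sup>2 = (\<Sum>j<N. M i j * X j x)"
    and sep: "\<And>x y. x \<in> S \<Longrightarrow> y \<in> S \<Longrightarrow> x \<noteq> y \<Longrightarrow> \<exists>i<N. X i x \<noteq> X i y"
  shows "card S \<le> 2 ^ N"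
proof -
  interpret vs: vector_space "\<lambda>(c::'a) (f::'p \<Rightarrow> 'a) x. c * f x"
    by unfold_locales (auto simp: fun_eq_iff algebra_simps)
  \<comment> \<open>Cutting off to 0 outside \<open>S\<close> makes the functions in the span depend
    only on their values at the solutions, where the quadratic equations hold.\<close>
  define m where "m = (\<lambda>T x. if x \<in> S then \<Prod>i\<in>T. X i x else 0)"
  define B where "B = m ` Pow {..<N}"
  define W where "W = vs.span B"
  have finB: "finite B" by (simp add: B_def)
  have "card B \<le> card (Pow {..<N})" unfolding B_def by (rule card_image_le) simp
  then have cardB: "card B \<le> 2 ^ N" by (simp add: card_Pow)
  have mono: "(\<lambda>x. X i x * m T x) \<in> W" if "i < N" "T \<subseteq> {..<N}" for i T
    using that
  proof (induction "card T" arbitrary: i T rule: less_induct)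
    case less
    have finT: "finite T" using less.prems(2) finite_subset by blast
    show ?case
    proof (cases "i \<in> T")
      case False
      then have "(\<lambda>x. X i x * m T x) = m (insert i T)"
        using finT by (auto simp: m_def)
      then show ?thesis
        using less.prems unfolding W_def B_def by (auto intro!: vs.span_base)
    next
      case True
      \<comment> \<open>The linear form may bring in an index j already in T - {i}; the induction on
        \<open>card T\<close>, over all indices, absorbs this.\<close>
      have "X i x * m T x = (\<Sum>j<N. M i j * (X j x * m (T - {i}) x))" for x
      proof (cases "x \<in> S")
        case True
        have "X i x * m T x = (X i x)\<^sup>2 * (\<Prod>j\<in>T - {i}. X j x)"
          using \<open>i \<in> T\<close> finT True by (simp add: m_def prod.remove power2_eq_square)
        also have "\<dots> = (\<Sum>j<N. M i j * (X j x * (\<Prod>j\<in>T - {i}. X j x)))"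
          using eq[OF True less.prems(1)] by (simp add: sum_distrib_right mult.assoc)
        finally show ?thesis using True by (simp add: m_def)
      qed (simp add: m_def)
      then have "(\<lambda>x. X i x * m T x) = (\<Sum>j<N. (\<lambda>x. M i j * (X j x * m (T - {i}) x)))"
        by (simp add: fun_eq_iff sum_fun_apply)
      also have "\<dots> \<in> W"
        unfolding W_def
      proof (rule vs.span_sum, rule vs.span_scale, fold W_def)
        fix j assume "j \<in> {..<N}"
        moreover have "card (T - {i}) < card T"
          using True finT by (rule card_Diff1_less[rotated])
        ultimately show "(\<lambda>x. X j x * m (T - {i}) x) \<in> W"
          using less.hyps[of "T - {i}" j] less.prems by auto
      qed
      finally show ?thesis .
    qed
  qed
  \<comment> \<open>Closure under multiplication by the coordinates puts every polynomial in them,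
    cut off to \<open>S\<close>, into W; interpolation then becomes available.\<close>
  have mult: "(\<lambda>x. X i x * f x) \<in> W" if "f \<in> W" "i < N" for i f
    using that(1) unfolding W_def
  proof (induction rule: vs.span_induct_alt)
    case base
    show ?case using vs.span_zero by (simp add: zero_fun_def)
  next
    case (step c f g)
    have "(\<lambda>x. X i x * f x) \<in> vs.span B"
      using step(1) mono[OF that(2)] unfolding W_def B_def by auto
    moreover have "(\<lambda>x. X i x * ((\<lambda>x. c * f x) + g) x) = (\<lambda>x. c * (X i x * f x)) + (\<lambda>x. X i x * g x)"
      by (simp add: fun_eq_iff algebra_simps)
    ultimately show ?case
      using step(2) by (simp only:) (intro vs.span_add vs.span_scale)
  qed
  have outside: "f x = 0" if "f \<in> W" "x \<notin> S" for f x
    using that(1) unfolding W_def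
    by (induction rule: vs.span_induct_alt) (use that(2) in \<open>auto simp: B_def m_def\<close>)
  have sepfun: "\<exists>f\<in>W. f y = 1 \<and> (\<forall>x\<in>R. f x = 0)" if y: "y \<in> S" and R: "R \<subseteq> S - {y}" for y R
  proof -
    have "finite R" using R fin finite_subset by blast
    then show ?thesis using R
    proof (induction R rule: finite_induct)
      case empty
      have "m {} \<in> W" unfolding W_def B_def by (intro vs.span_base) auto
      then show ?case using y by (intro bexI[of _ "m {}"]) (auto simp: m_def)
    next
      case (insert z R)
      then obtain f where f: "f \<in> W" "f y = 1" "\<forall>x\<in>R. f x = 0" by auto
      from insert.prems obtain i where i: "i < N" "X i z \<noteq> X i y"
        using sep[of z y] y by auto
      \<comment> \<open>The Lagrange factor (X i - X i z)/(X i y - X i z) adds the zero z and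
        preserves the value 1 at y.\<close>
      define g where "g = (\<lambda>x. inverse (X i y - X i z) * ((\<lambda>x. X i x * f x) - (\<lambda>x. X i z * f x)) x)"
      have "g \<in> W"
        unfolding g_def W_def
        by (rule vs.span_scale, rule vs.span_diff) (use mult[OF f(1) i(1)] f(1) vs.span_scale in \<open>auto simp: W_def\<close>)
      moreover have "g y = 1" using i f by (simp add: g_def)
      moreover have "g x = 0" if "x \<in> insert z R" for x
        using that f by (auto simp: g_def)
      ultimately show ?case by blast
    qed
  qed
  \<comment> \<open>Indicators of the points of \<open>S\<close> are independent and lie in the span
    of the monomials, so there are no more points than monomials.\<close>
  define dl where "dl = (\<lambda>(y::'p) x. if x = y then 1 else 0 :: 'a)"
  have "dl y \<in> W" if y: "y \<in> S" for y
  proof -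
    obtain f where f: "f \<in> W" "f y = 1" "\<forall>x\<in>S - {y}. f x = 0"
      using sepfun[OF y order_refl] by blast
    then have "f = dl y" using outside[OF f(1)] by (auto simp: dl_def fun_eq_iff)
    with f show ?thesis by simp
  qed
  then have sub: "dl ` S \<subseteq> vs.span B" by (auto simp: W_def)
  have inj: "inj_on dl S"
    by (auto simp: inj_on_def dl_def fun_eq_iff split: if_splits)
  have "vs.independent (dl ` S)"
  proof
    assume "vs.dependent (dl ` S)"
    then obtain u v where u: "v \<in> dl ` S" "u v \<noteq> 0" "(\<Sum>v\<in>dl ` S. (\<lambda>x. u v * v x)) = 0"
      unfolding vs.dependent_finite[OF finite_imageI[OF fin]] by blast
    from u(1) obtain y where y: "y \<in> S" "v = dl y" by auto
    have "0 = (\<Sum>v\<in>dl ` S. (\<lambda>x. u v * v x)) y" by (simp only: u(3) zero_fun_apply)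
    also have "\<dots> = (\<Sum>z\<in>S. u (dl z) * dl z y)"
      by (simp add: sum_fun_apply sum.reindex[OF inj])
    also have "\<dots> = (\<Sum>z\<in>S. if y = z then u (dl z) else 0)"
      by (intro sum.cong) (auto simp: dl_def)
    also have "\<dots> = u v" using y fin by simp
    finally show False using u(2) by simp
  qed
  from vs.independent_span_bound[OF finB this sub] have "card (dl ` S) \<le> card B" by blast
  then show ?thesis using cardB by (simp add: card_image[OF inj])
qed

section \<open>Interpolation, Vandermonde matrices and the solution set\<close>

lemma poly_eq_0_of_many_roots:
  fixes p :: "'a::idom poly"
  assumes "degree p < N" and "inj_on x {..<N}" and "\<And>i. i < N \<Longrightarrow> poly p (x i) = 0"
  shows "p = 0"
proof (rule ccontr)
  assume "p \<noteq> 0"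
  have "N = card (x ` {..<N})" using assms(2) by (simp add: card_image)
  also have "\<dots> \<le> card {z. poly p z = 0}"
    by (rule card_mono) (use poly_roots_finite[OF \<open>p \<noteq> 0\<close>] assms(3) in auto)
  also have "\<dots> \<le> degree p" by (rule card_poly_roots_bound[OF \<open>p \<noteq> 0\<close>])
  finally show False using assms(1) by simp
qed

lemma vandermonde_carrier: "vandermonde N x \<in> carrier_mat N N"
  by (simp add: vandermonde_def)

lemma vandermonde_mult_coeffs:
  assumes "degree p < N"
  shows "vandermonde N x *\<^sub>v vec N (coeff p) = vec N (\<lambda>i. poly p (x i))"
proof (rule eq_vecI)
  fix i assume "i < dim_vec (vec N (\<lambda>i. poly p (x i)))"
  then have i: "i < N" by simp
  have "poly p (x i) = (\<Sum>j\<in>{0..<N}. x i ^ j * coeff p j)"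
    unfolding poly_altdef
    by (rule sum.mono_neutral_cong_left) (use assms in \<open>auto simp: coeff_eq_0\<close>)
  then show "(vandermonde N x *\<^sub>v vec N (coeff p)) $ i = vec N (\<lambda>i. poly p (x i)) $ i"
    using i by (simp add: vandermonde_def scalar_prod_def)
qed (simp add: vandermonde_def)

text \<open>A kernel vector is the coefficient vector of a polynomial of degree below N with N
  distinct zeros, hence 0. The determinant is therefore nonzero, and \<open>mat_inverse\<close> does
  not return \<open>None\<close>.\<close>

lemma vandermonde_inverse:
  assumes "inj_on x {..<N}"
  obtains W where "mat_inverse (vandermonde N x) = Some W" "W \<in> carrier_mat N N"
    "W * vandermonde N x = 1\<^sub>m N"
proof -
  let ?V = "vandermonde N x"
  have "det ?V \<noteq> 0"
  proof
    assume "det ?V = 0"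
    then obtain v where v: "v \<in> carrier_vec N" "v \<noteq> 0\<^sub>v N" "?V *\<^sub>v v = 0\<^sub>v N"
      using det_0_iff_vec_prod_zero_field[OF vandermonde_carrier] by blast
    define p where "p = (\<Sum>j<N. monom (v $ j) j)"
    have N: "N > 0" using v(1,2) by (cases N) auto
    have coeff: "coeff p j = (if j < N then v $ j else 0)" for j
      by (simp add: p_def coeff_sum)
    have deg: "degree p < N"
      using N by (intro degree_lessI) (auto simp: coeff)
    have "v = vec N (coeff p)" using v(1) by (auto simp: coeff)
    then have "vec N (\<lambda>i. poly p (x i)) = 0\<^sub>v N"
      using v(3) vandermonde_mult_coeffs[OF deg] by metis
    then have "poly p (x i) = 0" if "i < N" for i
      using that by (metis index_vec index_zero_vec(1))
    then have "p = 0" by (rule poly_eq_0_of_many_roots[OF deg assms])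
    then have "v = 0\<^sub>v N" using \<open>v = vec N (coeff p)\<close> by auto
    with v(2) show False by simp
  qed
  then have unit: "?V \<in> Units (ring_mat TYPE(complex) N ())"
    by (rule det_non_zero_imp_unit[OF vandermonde_carrier])
  have "mat_inverse ?V \<noteq> None"
  proof
    assume "mat_inverse ?V = None"
    from mat_inverse(1)[OF vandermonde_carrier this, where b = "()"] unit show False ..
  qed
  then obtain W where "mat_inverse ?V = Some W" by blast
  with mat_inverse(2)[OF vandermonde_carrier this] that show ?thesis by blast
qed

lemma Mmat_carrier:
  assumes "inj_on \<delta> {..<N}"
  shows "Mmat N \<delta> e \<in> carrier_mat N N"
proof -
  have "inj_on (\<lambda>i. - \<delta> i) {..<N}" using assms by (auto simp: inj_on_def)
  then obtain W where "mat_inverse (vandermonde N (\<lambda>i. - \<delta> i)) = Some W" "W \<in> carrier_mat N N"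
    by (rule vandermonde_inverse)
  then show ?thesis
    unfolding Mmat_def by (auto intro!: mult_carrier_mat[of _ N N] vandermonde_carrier)
qed

text \<open>The inverse Vandermonde factor recovers the coefficients of \<open>p\<close> from its
  values at the reflected points, the second factor evaluates at the \<delta> i, and the diagonal
  multiplies by e. This is how M encodes passing from a(-s) to e(s) a(s).\<close>

lemma Mmat_mult_eval:
  assumes "inj_on \<delta> {..<N}" and "degree p < N" and "i < N"
  shows "(Mmat N \<delta> e *\<^sub>v vec N (\<lambda>i. poly p (- \<delta> i))) $ i = poly (cpoly e) (\<delta> i) * poly p (\<delta> i)"
proof -
  have "inj_on (\<lambda>i. - \<delta> i) {..<N}" using assms(1) by (auto simp: inj_on_def)
  then obtain W where W: "mat_inverse (vandermonde N (\<lambda>i. - \<delta> i)) = Some W" "W \<in> carrier_mat N N"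
      "W * vandermonde N (\<lambda>i. - \<delta> i) = 1\<^sub>m N"
    by (rule vandermonde_inverse)
  let ?D = "mat N N (\<lambda>(i,j). if i = j then poly (cpoly e) (\<delta> i) else 0)"
  let ?V = "vandermonde N \<delta>" and ?V' = "vandermonde N (\<lambda>i. - \<delta> i)"
  let ?c = "vec N (coeff p)"
  note car = vandermonde_carrier[of N \<delta>] vandermonde_carrier[of N "\<lambda>i. - \<delta> i"] W(2)
  have D: "?D \<in> carrier_mat N N" by simp
  have "Mmat N \<delta> e *\<^sub>v vec N (\<lambda>i. poly p (- \<delta> i)) = (?D * ?V * W) *\<^sub>v (?V' *\<^sub>v ?c)"
    using vandermonde_mult_coeffs[OF assms(2), of "\<lambda>i. - \<delta> i"] W(1) by (simp add: Mmat_def)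
  also have "\<dots> = (?D * ?V) *\<^sub>v (W *\<^sub>v (?V' *\<^sub>v ?c))"
    using car D by (intro assoc_mult_mat_vec[where n\<^sub>1 = N and n\<^sub>2 = N and n\<^sub>3 = N]) auto
  also have "W *\<^sub>v (?V' *\<^sub>v ?c) = (W * ?V') *\<^sub>v ?c"
    using car by (intro assoc_mult_mat_vec[symmetric, where n\<^sub>1 = N and n\<^sub>2 = N and n\<^sub>3 = N]) auto
  also have "\<dots> = ?c" using W(3) by simp
  also have "(?D * ?V) *\<^sub>v ?c = ?D *\<^sub>v (?V *\<^sub>v ?c)"
    using car D by (intro assoc_mult_mat_vec[where n\<^sub>1 = N and n\<^sub>2 = N and n\<^sub>3 = N]) auto
  also have "?V *\<^sub>v ?c = vec N (\<lambda>i. poly p (\<delta> i))"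
    by (rule vandermonde_mult_coeffs[OF assms(2)])
  also have "(?D *\<^sub>v vec N (\<lambda>i. poly p (\<delta> i))) $ i
      = (\<Sum>j\<in>{0..<N}. (if i = j then poly (cpoly e) (\<delta> i) else 0) * poly p (\<delta> j))"
    using assms(3) by (simp add: scalar_prod_def)
  also have "\<dots> = (\<Sum>j\<in>{0..<N}. if i = j then poly (cpoly e) (\<delta> i) * poly p (\<delta> i) else 0)"
    by (intro sum.cong) auto
  also have "\<dots> = poly (cpoly e) (\<delta> i) * poly p (\<delta> i)"
    using assms(3) by simp
  finally show ?thesis .
qed

lemma Xi_finite_card:
  assumes "inj_on \<delta> {..<N}"
  shows "finite (Xi N \<delta> e)" and "card (Xi N \<delta> e) \<le> 2 ^ N - 1"
proof -
  let ?M = "Mmat N \<delta> e"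
  let ?S = "insert (0\<^sub>v N) (Xi N \<delta> e)"
  have M: "?M \<in> carrier_mat N N" by (rule Mmat_carrier[OF assms])
  have car: "x \<in> carrier_vec N" if "x \<in> ?S" for x using that by (auto simp: Xi_def)
  have eq: "(x $ i)\<^sup>2 = (\<Sum>j<N. ?M $$ (i, j) * x $ j)" if "x \<in> ?S" "i < N" for x i
  proof -
    have "(x $ i)\<^sup>2 = (?M *\<^sub>v x) $ i"
      using that M by (auto simp: Xi_def)
    also have "\<dots> = (\<Sum>j<N. ?M $$ (i, j) * x $ j)"
      using that(2) M car[OF that(1)] by (simp add: scalar_prod_def lessThan_atLeast0)
    finally show ?thesis .
  qed
  have "finite ?S \<and> card ?S \<le> 2 ^ N"
  \<comment> \<open>The counting lemma speaks of finite sets only; its bound is uniform over the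
    finite subsets, which yields finiteness as well.\<close>
  proof (rule finite_if_finite_subsets_card_bdd)
    fix G assume G: "G \<subseteq> ?S" "finite G"
    show "card G \<le> 2 ^ N"
    proof (rule quadratic_system_card_le[OF G(2), where X = "\<lambda>i x. vec_index x i" and M = "\<lambda>i j. ?M $$ (i, j)"])
      show "(x $ i)\<^sup>2 = (\<Sum>j<N. ?M $$ (i, j) * x $ j)" if "x \<in> G" "i < N" for x i
        using eq G that by blast
      show "\<exists>i<N. x $ i \<noteq> y $ i" if "x \<in> G" "y \<in> G" "x \<noteq> y" for x y
        using that G car by (metis carrier_vecD eq_vecI subsetD)
    qed
  qed
  moreover have "0\<^sub>v N \<notin> Xi N \<delta> e" by (simp add: Xi_def)
  ultimately show "finite (Xi N \<delta> e)" "card (Xi N \<delta> e) \<le> 2 ^ N - 1" by auto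
qed

section \<open>Critical points\<close>

lemma critical_point_equation:
  assumes crit: "critical_point (H2_err_sq e d) (N - 1) b a"
    and N: "N \<ge> 2" and d: "hurwitz d" "degree d = N" and e: "degree e \<le> N - 1" and cop: "coprime e d"
  obtains q0 where "q0 \<noteq> 0" "b * d = e * a - Polynomial.smult q0 ((refl_poly a)\<^sup>2)"
proof -
  have a: "degree a = N - 1" "hurwitz a" and b: "degree b < N - 1"
    using crit by (auto simp: critical_point_def SigmaS_def)
  have nz: "a \<noteq> 0" "d \<noteq> 0" using a d hurwitz_nonzero by blast+
  have "(refl_poly a)\<^sup>2 dvd e * a - b * d"
    using critical_point_refl_dvd[OF crit d(1)] d(2) e N by simp
  then obtain q where q: "e * a - b * d = q * (refl_poly a)\<^sup>2"
    by (metis dvdE mult.commute)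
  have nzr: "(refl_poly a)\<^sup>2 \<noteq> 0" using nz by (auto dest: pcompose_eq_0)
  \<comment> \<open>Otherwise e/d = b/a, impossible because e/d is in lowest terms and d has the
    larger degree.\<close>
  have "q \<noteq> 0"
  proof
    assume "q = 0"
    then have "d dvd e * a" using q by (metis dvd_triv_right eq_iff_diff_eq_0 mult_zero_left)
    then have "d dvd a" using cop by (metis coprime_commute coprime_dvd_mult_right_iff)
    then have "degree d \<le> degree a" using nz by (intro dvd_imp_degree_le)
    then show False using a d N by simp
  qed
  \<comment> \<open>Here deg b is at most N - 2, so b d also stays within 2(N - 1), the degree of
    a*^2; the cofactor q must be constant.\<close>
  have "degree (e * a - b * d) \<le> 2 * (N - 1)"
  proof (rule degree_diff_le)
    show "degree (e * a) \<le> 2 * (N - 1)" using degree_mult_le[of e a] e a by linarith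
    show "degree (b * d) \<le> 2 * (N - 1)" using degree_mult_le[of b d] b d by linarith
  qed
  then have "degree q + 2 * (N - 1) \<le> 2 * (N - 1)"
    unfolding q degree_mult_eq[OF \<open>q \<noteq> 0\<close> nzr] using nz a nzr by (simp add: degree_power_eq)
  then have "degree q = 0" by simp
  then obtain q0 where q0: "q = [:q0:]" by (rule degree_eq_zeroE)
  show ?thesis
  proof (rule that)
    show "q0 \<noteq> 0" using \<open>q \<noteq> 0\<close> q0 by simp
    show "b * d = e * a - Polynomial.smult q0 ((refl_poly a)\<^sup>2)"
      using q unfolding q0 by (simp add: algebra_simps)
  qed
qed

lemma critical_value_in_Xi:
  assumes "q0 \<noteq> 0" and eq: "b * d = e * a - Polynomial.smult q0 ((refl_poly a)\<^sup>2)"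
    and a: "degree a < N" "a \<noteq> 0"
    and droot: "\<And>i. i < N \<Longrightarrow> poly (cpoly d) (\<delta> i) = 0" and inj: "inj_on \<delta> {..<N}"
  shows "vec N (\<lambda>i. of_real q0 * poly (cpoly a) (- \<delta> i)) \<in> Xi N \<delta> e" (is "?x \<in> _")
proof -
  let ?p = "Polynomial.smult (of_real q0) (cpoly a)"
  have inj': "inj_on (\<lambda>i. - \<delta> i) {..<N}" using inj by (auto simp: inj_on_def)
  have x: "?x = vec N (\<lambda>i. poly ?p (- \<delta> i))" by simp
  have deg: "degree ?p < N" using a assms(1) by (simp add: degree_cpoly)
  have "?p \<noteq> 0" using assms(1) a cpoly_eq_iff[of a 0] by simp
  then obtain i where "i < N" "poly ?p (- \<delta> i) \<noteq> 0"
    using poly_eq_0_of_many_roots[OF deg inj'] by blast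
  then have "?x \<noteq> 0\<^sub>v N"
    unfolding x by (metis index_vec index_zero_vec(1))
  moreover have "(?x $ i)\<^sup>2 = (Mmat N \<delta> e *\<^sub>v ?x) $ i" if i: "i < N" for i
  proof -
    have "poly (cpoly (b * d)) (\<delta> i) = poly (cpoly (e * a - Polynomial.smult q0 ((refl_poly a)\<^sup>2))) (\<delta> i)"
      by (simp only: eq)
    then have "poly (cpoly e) (\<delta> i) * poly (cpoly a) (\<delta> i) = of_real q0 * (poly (cpoly a) (- \<delta> i))\<^sup>2"
      using droot[OF i] by (simp add: cpoly_mult cpoly_diff cpoly_smult cpoly_power poly_cpoly_refl)
    \<comment> \<open>Multiplying by q0 absorbs it into the unknown q0 a, which makes the system
      independent of q0.\<close>
    then have "poly (cpoly e) (\<delta> i) * poly ?p (\<delta> i) = (of_real q0 * poly (cpoly a) (- \<delta> i))\<^sup>2"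
      by (simp add: power_mult_distrib power2_eq_square mult_ac)
    then show ?thesis
      using Mmat_mult_eval[OF inj deg i, of e] i unfolding x by simp
  qed
  ultimately show ?thesis by (simp add: Xi_def)
qed

text \<open>Two scalars are allowed because injectivity compares critical points whose values of q0
  may differ; uniqueness of a is the case r = s.\<close>

lemma poly_eq_of_scaled_values:
  fixes p q :: "complex poly"
  assumes inj: "inj_on \<delta> {..<N}" and deg: "degree p < N" "degree q < N"
    and eq: "\<And>i. i < N \<Longrightarrow> r * poly p (- \<delta> i) = s * poly q (- \<delta> i)"
  shows "Polynomial.smult r p = Polynomial.smult s q"
proof -
  have "inj_on (\<lambda>i. - \<delta> i) {..<N}" using inj by (auto simp: inj_on_def)
  moreover have "degree (Polynomial.smult r p - Polynomial.smult s q) < N"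
    using deg by (intro degree_diff_less) (auto intro: le_less_trans[OF degree_smult_le])
  ultimately have "Polynomial.smult r p - Polynomial.smult s q = 0"
    by (intro poly_eq_0_of_many_roots) (use eq in auto)
  then show ?thesis by simp
qed

theorem theorem6:
  fixes N :: nat and d e :: "real poly" and \<delta> :: "nat \<Rightarrow> complex"
  assumes N2: "N \<ge> 2"
    and d_fact: "cpoly d = (\<Prod>i<N. [:- \<delta> i, 1:])"
    and \<delta>_dist: "inj_on \<delta> {..<N}"
    and \<delta>_lhp: "\<forall>i<N. Re (\<delta> i) < 0"
    and e_deg: "degree e \<le> N - 1"
    and e_cop: "coprime e d"
  shows "(finite {(b, a). critical_point (H2_err_sq e d) (N - 1) b a}
       \<and> card {(b, a). critical_point (H2_err_sq e d) (N - 1) b a} \<le> 2 ^ N - 1)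
     \<and> (\<forall>b a. critical_point (H2_err_sq e d) (N - 1) b a \<longrightarrow>
       (\<exists>q0 :: real. \<exists>\<xi> \<in> Xi N \<delta> e.
          (\<forall>i<N. of_real q0 * poly (cpoly a) (- \<delta> i) = \<xi> $ i)
        \<and> (\<forall>p :: complex poly. degree p \<le> N - 1 \<longrightarrow>
              (\<forall>i<N. of_real q0 * poly p (- \<delta> i) = \<xi> $ i) \<longrightarrow> p = cpoly a)
        \<and> b * d = e * a - Polynomial.smult q0 ((a \<circ>\<^sub>p [:0, -1:])\<^sup>2)))"
proof -
  let ?crit = "critical_point (H2_err_sq e d) (N - 1)"
  have "degree (cpoly d) = N"
    unfolding d_fact by (subst degree_prod_eq_sum_degree) auto
  then have deg_d: "degree d = N" by (simp add: degree_cpoly)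
  have droot: "poly (cpoly d) z = 0 \<longleftrightarrow> (\<exists>i<N. z = \<delta> i)" for z
    unfolding d_fact by (auto simp: poly_prod)
  have hur_d: "hurwitz d" using \<delta>_lhp by (auto simp: hurwitz_def droot)
  have crit_a: "degree a = N - 1" "lead_coeff a = 1" "a \<noteq> 0" if "?crit b a" for b a
    using that N2 by (auto simp: critical_point_def SigmaS_def)
  have "\<forall>ba. \<exists>q0. ?crit (fst ba) (snd ba) \<longrightarrow> q0 \<noteq> 0 \<and>
      fst ba * d = e * snd ba - Polynomial.smult q0 ((refl_poly (snd ba))\<^sup>2)"
    using critical_point_equation[OF _ N2 hur_d deg_d e_deg e_cop] by metis
  then obtain Q where Q: "\<And>b a. ?crit b a \<Longrightarrow> Q (b, a) \<noteq> 0"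
      "\<And>b a. ?crit b a \<Longrightarrow> b * d = e * a - Polynomial.smult (Q (b, a)) ((refl_poly a)\<^sup>2)"
    by (metis fst_conv snd_conv)
  define \<Phi> where "\<Phi> = (\<lambda>(b, a). vec N (\<lambda>i. of_real (Q (b, a)) * poly (cpoly a) (- \<delta> i)))"
  have \<Phi>_Xi: "\<Phi> (b, a) \<in> Xi N \<delta> e" if "?crit b a" for b a
    unfolding \<Phi>_def prod.case
    by (rule critical_value_in_Xi[OF Q[OF that]]) (use crit_a[OF that] N2 droot \<delta>_dist in auto)
  have inj: "inj_on \<Phi> {(b, a). ?crit b a}"
  proof (rule inj_onI, clarify)
    fix b a b' a' assume c: "?crit b a" "?crit b' a'" and eq: "\<Phi> (b, a) = \<Phi> (b', a')"
    have "of_real (Q (b, a)) * poly (cpoly a) (- \<delta> i) = of_real (Q (b', a')) * poly (cpoly a') (- \<delta> i)"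
      if "i < N" for i
      using arg_cong[OF eq, of "\<lambda>v. vec_index v i"] that by (simp add: \<Phi>_def)
    then have "cpoly (Polynomial.smult (Q (b, a)) a) = cpoly (Polynomial.smult (Q (b', a')) a')"
      unfolding cpoly_smult
      by (intro poly_eq_of_scaled_values[OF \<delta>_dist]) (use crit_a[OF c(1)] crit_a[OF c(2)] N2 in \<open>auto simp: degree_cpoly\<close>)
    then have sm: "Polynomial.smult (Q (b, a)) a = Polynomial.smult (Q (b', a')) a'"
      by (simp add: cpoly_eq_iff)
    \<comment> \<open>Both denominators are monic of degree N - 1, so this coefficient is q0; then a
      follows, and b by cancelling d.\<close>
    from arg_cong[OF sm, of "\<lambda>p. coeff p (N - 1)"] have QQ: "Q (b, a) = Q (b', a')"
      using crit_a[OF c(1)] crit_a[OF c(2)] by simp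
    then have aa: "a = a'" using sm Q(1)[OF c(1)] by (simp add: smult_eq_iff)
    have "b * d = b' * d" unfolding Q(2)[OF c(1)] Q(2)[OF c(2)] using aa QQ by simp
    then show "b = b' \<and> a = a'" using aa hurwitz_nonzero[OF hur_d] by simp
  qed
  have sub: "\<Phi> ` {(b, a). ?crit b a} \<subseteq> Xi N \<delta> e" using \<Phi>_Xi by auto
  have "finite {(b, a). ?crit b a}"
    by (rule inj_on_finite[OF inj sub Xi_finite_card(1)[OF \<delta>_dist]])
  moreover have "card {(b, a). ?crit b a} \<le> 2 ^ N - 1"
    using card_inj_on_le[OF inj sub Xi_finite_card(1)[OF \<delta>_dist]] Xi_finite_card(2)[OF \<delta>_dist, of e]
    by (rule order_trans)
  moreover have "\<exists>q0 :: real. \<exists>\<xi> \<in> Xi N \<delta> e.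
          (\<forall>i<N. of_real q0 * poly (cpoly a) (- \<delta> i) = \<xi> $ i)
        \<and> (\<forall>p :: complex poly. degree p \<le> N - 1 \<longrightarrow>
              (\<forall>i<N. of_real q0 * poly p (- \<delta> i) = \<xi> $ i) \<longrightarrow> p = cpoly a)
        \<and> b * d = e * a - Polynomial.smult q0 ((refl_poly a)\<^sup>2)" if c: "?crit b a" for b a
  proof (intro exI[of _ "Q (b, a)"] bexI[of _ "\<Phi> (b, a)"] conjI allI impI)
    show "of_real (Q (b, a)) * poly (cpoly a) (- \<delta> i) = \<Phi> (b, a) $ i" if "i < N" for i
      using that by (simp add: \<Phi>_def)
    fix p :: "complex poly"
    assume p: "degree p \<le> N - 1" "\<forall>i<N. of_real (Q (b, a)) * poly p (- \<delta> i) = \<Phi> (b, a) $ i"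
    have "Polynomial.smult (of_real (Q (b, a))) p = Polynomial.smult (of_real (Q (b, a))) (cpoly a)"
      by (rule poly_eq_of_scaled_values[OF \<delta>_dist]) (use p crit_a[OF c] N2 in \<open>auto simp: degree_cpoly \<Phi>_def\<close>)
    then show "p = cpoly a" using Q(1)[OF c] by (simp add: smult_eq_iff)
  qed (use Q(2)[OF c] \<Phi>_Xi[OF c] in auto)
  ultimately show ?thesis by blast
qed

end
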